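(* Hamilton Cycle is solvable in polynomial time on the class of $\mathbb{H}_1$-subgraph-free graphs.
   Context: All graphs are finite and simple. A graph $G$ is $H$-subgraph-free if it does not contain $H$ as a (not necessarily induced) subgraph. The graph $\mathbb{H}_1$ is the six-vertex graph obtained from two vertex-disjoint paths on three vertices by adding an edge joining their two middle vertices. The problem Hamilton Cycle: given a graph $G$, decide whether $G$ contains a cycle visiting every vertex exactly once. *)

theory Defs
  imports Complex_Main "HOL-Computational_Algebra.Polynomial"
begin

section \<open>Finite simple graphs\<close>

record 'a ugraph =
  verts :: "'a set"
  edges :: "'a set set"

definition simple_graph :: "'a ugraph \<Rightarrow> bool" where
  "simple_graph G \<longleftrightarrow> finite (verts G) \<and> (\<forall>e\<in>edges G. e \<subseteq> verts G \<and> card e = 2)"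

definition subgraph_of :: "'a ugraph \<Rightarrow> 'a ugraph \<Rightarrow> bool" where
  "subgraph_of G' G \<longleftrightarrow>
     simple_graph G' \<and> verts G' \<subseteq> verts G \<and> edges G' \<subseteq> edges G"

definition isomorphic :: "'a ugraph \<Rightarrow> 'b ugraph \<Rightarrow> bool" where
  "isomorphic G H \<longleftrightarrow>
     (\<exists>f. bij_betw f (verts G) (verts H) \<and> edges H = (\<lambda>e. f ` e) ` edges G)"

definition subgraph_free :: "'b ugraph \<Rightarrow> 'a ugraph \<Rightarrow> bool" where
  "subgraph_free H G \<longleftrightarrow> \<not> (\<exists>G'. subgraph_of G' G \<and> isomorphic G' H)"

definition graph_H1 :: "nat ugraph" where
  "graph_H1 = \<lparr> verts = {0, 1, 2, 3, 4, 5},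
                edges = {{0, 1}, {1, 2}, {3, 4}, {4, 5}, {1, 4}} \<rparr>"

lemma simple_graph_H1: "simple_graph graph_H1"
  by (simp add: simple_graph_def graph_H1_def)

text \<open>A cycle is given by its vertices in cyclic order. Without the bound on the length, a single
  edge, traversed back and forth, would count as a cycle.\<close>

definition is_cycle :: "'a ugraph \<Rightarrow> 'a list \<Rightarrow> bool" where
  "is_cycle G vs \<longleftrightarrow>
     3 \<le> length vs \<and> distinct vs \<and> set vs \<subseteq> verts G \<and>
     (\<forall>i<length vs. {vs ! i, vs ! (Suc i mod length vs)} \<in> edges G)"

definition has_hamilton_cycle :: "'a ugraph \<Rightarrow> bool" where
  "has_hamilton_cycle G \<longleftrightarrow> (\<exists>vs. is_cycle G vs \<and> set vs = verts G)"


section \<open>Random access machine programs with unit cost\<close>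

text \<open>
  A configuration consists of registers, of which any program mentions only finitely many, and an
  indirectly addressed memory; all cells hold natural numbers. The arithmetic operations are addition
  and truncated subtraction. There is deliberately no multiplication: a step increases the
  bit length of the largest number stored by at most one (up to a constant depending on the
  program), so unit-cost time is polynomially related to time on a Turing machine. Every elementary
  instruction and every evaluation of a branching condition takes one unit of time.
\<close>

type_synonym config = "(nat \<Rightarrow> nat) \<times> (nat \<Rightarrow> nat)"

datatype prog =
    Const nat nat
  | Add nat nat nat
  | Sub nat nat nat
  | Load nat nat
  | Store nat nat
  | Seq prog prog
  | Cond nat prog prog
  | While nat prog

inductive exec :: "prog \<Rightarrow> config \<Rightarrow> nat \<Rightarrow> config \<Rightarrow> bool" where
  Const: "exec (Const i k) (r, m) 1 (r(i := k), m)"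
| Add: "exec (Add i j k) (r, m) 1 (r(i := r j + r k), m)"
| Sub: "exec (Sub i j k) (r, m) 1 (r(i := r j - r k), m)"
| Load: "exec (Load i j) (r, m) 1 (r(i := m (r j)), m)"
| Store: "exec (Store i j) (r, m) 1 (r, m(r i := r j))"
| Seq: "exec p s t s' \<Longrightarrow> exec q s' t' s'' \<Longrightarrow> exec (Seq p q) s (t + t') s''"
| CondTrue: "r i \<noteq> 0 \<Longrightarrow> exec p (r, m) t s' \<Longrightarrow> exec (Cond i p q) (r, m) (Suc t) s'"
| CondFalse: "r i = 0 \<Longrightarrow> exec q (r, m) t s' \<Longrightarrow> exec (Cond i p q) (r, m) (Suc t) s'"
| WhileFalse: "r i = 0 \<Longrightarrow> exec (While i p) (r, m) 1 (r, m)"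
| WhileTrue: "r i \<noteq> 0 \<Longrightarrow> exec p (r, m) t s' \<Longrightarrow> exec (While i p) s' t' s'' \<Longrightarrow>
    exec (While i p) (r, m) (Suc (t + t')) s''"

inductive_cases exec_ConstE: "exec (Const i k) s t s'"
inductive_cases exec_AddE: "exec (Add i j k) s t s'"
inductive_cases exec_SubE: "exec (Sub i j k) s t s'"
inductive_cases exec_LoadE: "exec (Load i j) s t s'"
inductive_cases exec_StoreE: "exec (Store i j) s t s'"
inductive_cases exec_SeqE: "exec (Seq p q) s t s'"
inductive_cases exec_CondE: "exec (Cond i p q) s t s'"
inductive_cases exec_WhileE: "exec (While i p) s t s'"

lemma exec_deterministic:
  "exec p s t s' \<Longrightarrow> exec p s u s'' \<Longrightarrow> t = u \<and> s' = s''"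
proof (induction arbitrary: u s'' rule: exec.induct)
  case (Seq p s t s' q t' s2)
  from Seq.prems show ?case
    by (rule exec_SeqE) (metis Seq.IH)
next
  case (CondTrue r i p m t s' q)
  from CondTrue.prems show ?case
    by (rule exec_CondE) (metis CondTrue.IH CondTrue.hyps(1) Pair_inject neq0_conv)+
next
  case (CondFalse r i q m t s' p)
  from CondFalse.prems show ?case
    by (rule exec_CondE) (metis CondFalse.IH CondFalse.hyps(1) Pair_inject neq0_conv)+
next
  case (WhileFalse r i p m)
  from WhileFalse.prems show ?case
    by (rule exec_WhileE) (metis WhileFalse.hyps Pair_inject neq0_conv One_nat_def)+
next
  case (WhileTrue r i p m t s' t' s2)
  from WhileTrue.prems show ?case
    by (rule exec_WhileE) (metis WhileTrue.IH WhileTrue.hyps(1) Pair_inject neq0_conv)+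
qed (erule exec_ConstE exec_AddE exec_SubE exec_LoadE exec_StoreE; simp)+

text \<open>The input word occupies the memory cells from address 0 on, and register 0 holds its
  length; everything else is 0.\<close>

definition initial_config :: "bool list \<Rightarrow> config" where
  "initial_config w =
     ((\<lambda>_. 0)(0 := length w), (\<lambda>a. if a < length w \<and> w ! a then 1 else 0))"


section \<open>Graph problems solvable in polynomial time on a class of graphs\<close>

text \<open>The adjacency matrix, row by row, with respect to an ordering of the vertices.\<close>

definition adjacency_word :: "'a list \<Rightarrow> 'a ugraph \<Rightarrow> bool list" where
  "adjacency_word vs G = concat (map (\<lambda>u. map (\<lambda>v. {u, v} \<in> edges G) vs) vs)"

text \<open>
  A single program and a single polynomial have to work for all graphs in the class and for all
  orderings of their vertices; the answer is read off register 0. Nothing is required on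
  inputs that do not represent a graph in the class. Every finite graph has an isomorphic copy with
  vertices in \<^typ>\<open>nat\<close>.
\<close>

definition solvable_in_polynomial_time_on ::
    "(nat ugraph \<Rightarrow> bool) \<Rightarrow> nat ugraph set \<Rightarrow> bool" where
  "solvable_in_polynomial_time_on Q C \<longleftrightarrow>
     (\<exists>(p :: prog) (b :: nat poly).
        \<forall>G vs. simple_graph G \<and> G \<in> C \<and> distinct vs \<and> set vs = verts G \<longrightarrow>
          (\<exists>t r m. exec p (initial_config (adjacency_word vs G)) t (r, m) \<and>
                   t \<le> poly b (length (adjacency_word vs G)) \<and>
                   r 0 = (if Q G then 1 else 0)))"

end

theory Submission
  imports Defs
begin

text \<open>
  In a Hamiltonian graph, both edges at a vertex of degree 2 belong to the cycle. If moreover the graph is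
  \<open>H\<^sub>1\<close>-subgraph-free and has at least six vertices, this bounds all degrees by 3, and each vertex
  of degree 3 either belongs to a triangle whose other two vertices have degrees 2 and 3, or to a diamond (\<open>K\<^sub>4\<close>
  minus an edge) all of whose vertices have degree 3. Conversely, in a connected graph with these local
  properties, deleting one edge at each vertex of degree 3, suitably chosen, leaves a connected
  2-regular graph. So, apart from graphs with at most five vertices, Hamiltonicity is
  the conjunction of a first-order property and connectivity, and first-order properties are
  decided in polynomial time by nested loops.
\<close>

section \<open>Hamilton cycles as connected 2-factors\<close>

text \<open>The threshold of six vertices comes from deleting one vertex of a Hamilton cycle, which
  leaves a path: a nonempty vertex set that the cycle leaves only towards one vertex
  \<open>u\<close> contains everything but \<open>u\<close>. A vertex of degree at least 4 turns out
  to have degree 4 and to confine the cycle to its closed neighbourhood, which has only five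
  vertices.

  At a vertex of degree 3 some neighbour has degree 3 as well, since otherwise all three edges would
  be forced; freeness then yields a triangle on that edge. If the three corners have degree 3 and
  distinct outside neighbours, the outgoing edges are forced, so each corner uses exactly one
  triangle edge: a perfect matching on three vertices, impossible by parity.

  Connectivity is the only ingredient that is not first-order. It enters the formula as a unary
  predicate for the vertices reached from the first one, computed beforehand and kept as marks in
  memory; the marking itself uses compiled formulas.\<close>

definition nb :: "'a ugraph \<Rightarrow> 'a \<Rightarrow> 'a set" where
  "nb G x = {y. {x, y} \<in> edges G}"

lemma nb_sym: "y \<in> nb G x \<longleftrightarrow> x \<in> nb G y"
  by (simp add: nb_def insert_commute)

lemma nb_irrefl: "simple_graph G \<Longrightarrow> x \<notin> nb G x"
  unfolding nb_def simple_graph_def by fastforce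

lemma nb_subset: "simple_graph G \<Longrightarrow> nb G x \<subseteq> verts G"
  unfolding nb_def simple_graph_def by auto

lemma finite_nb: "simple_graph G \<Longrightarrow> finite (nb G x)"
  using nb_subset finite_subset unfolding simple_graph_def by metis

lemma two_elements:
  assumes "2 \<le> card A"
  obtains a b where "a \<in> A" "b \<in> A" "a \<noteq> b"
proof -
  obtain B where "B \<subseteq> A" "card B = 2"
    using obtain_subset_with_card_n[OF assms] by blast
  then show ?thesis
    using that by (metis card_2_iff insert_subset)
qed

lemma H1_present:
  assumes G: "simple_graph G" and d: "distinct [u, v, a, b, c, d]"
    and "v \<in> nb G u" "a \<in> nb G u" "b \<in> nb G u" "c \<in> nb G v" "d \<in> nb G v"
  shows "\<not> subgraph_free graph_H1 G"
proof -
  define K where "K = \<lparr>verts = {a, u, b, c, v, d}, edges = {{a, u}, {u, b}, {c, v}, {v, d}, {u, v}}\<rparr>"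
  have e: "{u, v} \<in> edges G" "{u, a} \<in> edges G" "{u, b} \<in> edges G" "{v, c} \<in> edges G" "{v, d} \<in> edges G"
    using assms unfolding nb_def by auto
  have sub: "subgraph_of K G"
    unfolding subgraph_of_def K_def
  proof (intro conjI)
    show "simple_graph \<lparr>verts = {a, u, b, c, v, d}, edges = {{a, u}, {u, b}, {c, v}, {v, d}, {u, v}}\<rparr>"
      using d by (auto simp: simple_graph_def)
    show "verts \<lparr>verts = {a, u, b, c, v, d}, edges = {{a, u}, {u, b}, {c, v}, {v, d}, {u, v}}\<rparr> \<subseteq> verts G"
      using e G unfolding simple_graph_def by auto
    show "edges \<lparr>verts = {a, u, b, c, v, d}, edges = {{a, u}, {u, b}, {c, v}, {v, d}, {u, v}}\<rparr> \<subseteq> edges G"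
      using e by (simp add: insert_commute)
  qed
  \<comment> \<open>The default value 0 is the image of \<open>a\<close>. The numbering is that of
    \<open>graph_H1\<close>, with \<open>u\<close> and \<open>v\<close> going to the middle vertices
    1 and 4.\<close>
  define f :: "'a \<Rightarrow> nat" where "f = (\<lambda>_. 0)(u := 1, b := 2, c := 3, v := 4, d := 5)"
  have f: "f a = 0" "f u = 1" "f b = 2" "f c = 3" "f v = 4" "f d = 5"
    using d unfolding f_def by auto
  have "isomorphic K graph_H1"
    unfolding isomorphic_def
  proof (intro exI conjI)
    show "bij_betw f (verts K) (verts graph_H1)"
      unfolding K_def graph_H1_def bij_betw_def inj_on_def by (simp add: f)
    show "edges graph_H1 = (`) f ` edges K"
      unfolding K_def graph_H1_def by (simp add: f)
  qed
  with sub show ?thesis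
    unfolding subgraph_free_def by blast
qed

text \<open>Closed sets instead of walks: the proofs provide such sets directly, as sets closed
  under cycle edges or as sets of marked vertices.\<close>

definition graph_connected :: "'a ugraph \<Rightarrow> bool" where
  "graph_connected G \<longleftrightarrow>
     (\<forall>S \<subseteq> verts G. S \<noteq> {} \<longrightarrow> (\<forall>x\<in>S. nb G x \<subseteq> S) \<longrightarrow> S = verts G)"

definition two_regular :: "'a set \<Rightarrow> ('a \<Rightarrow> 'a \<Rightarrow> bool) \<Rightarrow> bool" where
  "two_regular V F \<longleftrightarrow> symp F \<and> (\<forall>x\<in>V. card {y. F x y} = 2)"

lemma two_regular_third:
  assumes "two_regular V F" "x \<in> V" "F x a" "F x b" "a \<noteq> b" "F x c"
  shows "c = a \<or> c = b"
proof -
  have "card {y. F x y} = 2"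
    using assms unfolding two_regular_def by blast
  then obtain p q where "{y. F x y} = {p, q}"
    by (meson card_2_iff)
  with assms show ?thesis
    by (metis insertE mem_Collect_eq singletonD)
qed

text \<open>\<open>F\<close> is adjacency along the cycle. The last property holds because removing
  \<open>u\<close> from a cycle leaves a path, which is connected.\<close>

lemma hamilton_cycle_2_factor:
  assumes "simple_graph G" "has_hamilton_cycle G"
  obtains F where "two_regular (verts G) F" "\<And>x y. F x y \<Longrightarrow> y \<in> nb G x"
    "\<And>u S. u \<in> verts G \<Longrightarrow> S \<subseteq> verts G \<Longrightarrow> u \<notin> S \<Longrightarrow> S \<noteq> {} \<Longrightarrow>
       (\<And>x y. x \<in> S \<Longrightarrow> F x y \<Longrightarrow> y \<in> insert u S) \<Longrightarrow> verts G \<subseteq> insert u S"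
proof -
  obtain vs where vs: "is_cycle G vs" "set vs = verts G"
    using assms unfolding has_hamilton_cycle_def by blast
  define n where "n = length vs"
  define w where "w k = vs ! (k mod n)" for k
  define F where "F x y \<longleftrightarrow> (\<exists>k. {x, y} = {w k, w (Suc k)})" for x y
  have n: "3 \<le> n" and dist: "distinct vs"
    using vs unfolding is_cycle_def n_def by auto
  have ltn: "i mod n < n" for i
    using n by (intro mod_less_divisor) linarith
  have w_eq: "w i = w j \<longleftrightarrow> i mod n = j mod n" for i j
  proof -
    have "i mod n < length vs" "j mod n < length vs"
      using ltn unfolding n_def by blast+
    then show ?thesis
      unfolding w_def n_def using dist by (simp add: nth_eq_iff_index_eq)
  qed
  have w_in: "w k \<in> verts G" for k
    unfolding w_def using ltn vs(2) by (metis n_def nth_mem)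
  have w_surj: "\<exists>k<n. x = w (j + k)" if xV: "x \<in> verts G" for x j
  proof -
    obtain i where i: "i < n" "x = vs ! i"
      using xV unfolding vs(2)[symmetric] in_set_conv_nth n_def by blast
    \<comment> \<open>The offset is \<open>i - j\<close> modulo \<open>n\<close>, arranged so that
      the subtraction does not truncate.\<close>
    have "w (j + (i + (n - j mod n)) mod n) = w i"
    proof -
      have "(j + (i + (n - j mod n)) mod n) mod n = (j mod n + (i + (n - j mod n))) mod n"
        by (rule trans[OF mod_add_right_eq mod_add_left_eq[symmetric]])
      also have "\<dots> = (i + n) mod n"
      proof -
        have "j mod n + (i + (n - j mod n)) = i + n"
          using ltn[of j] by linarith
        then show ?thesis by simp
      qed
      finally show ?thesis
        by (simp add: w_eq)
    qed
    moreover have "w i = x"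
      using i by (simp add: w_def)
    ultimately show ?thesis
      using ltn by metis
  qed
  have edge: "{w k, w (Suc k)} \<in> edges G" for k
  proof -
    have "{vs ! (k mod n), vs ! (Suc (k mod n) mod n)} \<in> edges G"
      using vs(1) ltn[of k] unfolding is_cycle_def n_def by blast
    then show ?thesis
      unfolding w_def by (simp add: mod_Suc_eq)
  qed
  have nbF: "y \<in> nb G x" if "F x y" for x y
    using that edge unfolding F_def nb_def by force
  have symF: "symp F"
    unfolding F_def by (auto intro!: sympI simp: insert_commute)
  \<comment> \<open>Writing the vertex with a successor index names its predecessor on the cycle
    without subtraction.\<close>
  have degF: "{y. F x y} = {w i, w (Suc (Suc i))}" if "x = w (Suc i)" for x i
  proof (intro equalityI subsetI)
    fix y assume "y \<in> {y. F x y}"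
    then obtain k where k: "{x, y} = {w k, w (Suc k)}"
      unfolding F_def by blast
    then consider "x = w k" "y = w (Suc k)" | "x = w (Suc k)" "y = w k"
      by (auto simp: doubleton_eq_iff)
    then show "y \<in> {w i, w (Suc (Suc i))}"
    proof cases
      case 1
      then have "k mod n = Suc i mod n"
        using that w_eq by metis
      then have "Suc k mod n = Suc (Suc i) mod n"
        by (metis mod_Suc_eq)
      with 1 w_eq show ?thesis by blast
    next
      case 2
      then have "Suc k mod n = Suc i mod n"
        using that w_eq by metis
      then have "k mod n = i mod n"
        using n by (auto simp: mod_Suc split: if_splits)
      with 2 w_eq show ?thesis by blast
    qed
  next
    fix y assume "y \<in> {w i, w (Suc (Suc i))}"
    then show "y \<in> {y. F x y}"
      using that unfolding F_def by (auto simp: insert_commute)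
  qed
  have reg: "two_regular (verts G) F"
    unfolding two_regular_def
  proof (intro conjI ballI symF)
    fix x assume "x \<in> verts G"
    then obtain k where "x = w (Suc k)"
      using w_surj[of x 1] by auto
    \<comment> \<open>The two cycle neighbours differ because the length is at least three.\<close>
    moreover have "w k \<noteq> w (Suc (Suc k))"
      using n by (auto simp: w_eq mod_Suc split: if_splits)
    ultimately show "card {y. F x y} = 2"
      by (simp add: degF)
  qed
  show ?thesis
  proof (rule that[OF reg nbF])
    fix u S assume u: "u \<in> verts G" "S \<subseteq> verts G" "u \<notin> S" "S \<noteq> {}"
      and closed: "\<And>x y. x \<in> S \<Longrightarrow> F x y \<Longrightarrow> y \<in> insert u S"
    obtain j where j: "u = w j"
      using w_surj[OF u(1), of 0] by auto
    obtain x where "x \<in> S"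
      using u by blast
    then obtain i where i: "i < n" "x = w (j + i)"
      using w_surj u(2) by blast
    have ne: "w (j + k) \<noteq> u" if "0 < k" "k < n" for k
    proof
      assume "w (j + k) = u"
      then have "(j + k) mod n = j mod n"
        by (simp only: j w_eq)
      then have "n dvd k"
        using mod_eq_dvd_iff_nat[of j "j + k" n] by simp
      with that show False
        by (auto dest: dvd_imp_le)
    qed
    have i0: "0 < i"
      using i j u(3) \<open>x \<in> S\<close> by (cases i) auto
    have FS: "F (w k) (w (Suc k))" "F (w (Suc k)) (w k)" for k
      unfolding F_def by auto
    \<comment> \<open>From one vertex of \<open>S\<close>, the path is followed in both directions;
      \<open>u\<close> occurs only at the offsets 0 and \<open>n\<close>, where the walk
      stops.\<close>
    have up: "i + t < n \<Longrightarrow> w (j + (i + t)) \<in> S" for t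
    proof (induction t)
      case 0
      then show ?case using i \<open>x \<in> S\<close> by simp
    next
      case (Suc t)
      then have "w (Suc (j + (i + t))) \<in> insert u S"
        using closed FS(1) by fastforce
      with ne[of "i + Suc t"] Suc.prems i0 show ?case by auto
    qed
    have down: "t < i \<Longrightarrow> w (j + (i - t)) \<in> S" for t
    proof (induction t)
      case 0
      then show ?case using i \<open>x \<in> S\<close> by simp
    next
      case (Suc t)
      then have "j + (i - t) = Suc (j + (i - Suc t))" by simp
      with Suc have "w (j + (i - Suc t)) \<in> insert u S"
        using closed FS(2) by (metis Suc_lessD)
      with ne[of "i - Suc t"] Suc.prems i(1) show ?case by auto
    qed
    show "verts G \<subseteq> insert u S"
    proof
      fix y assume "y \<in> verts G"
      then obtain k where k: "k < n" "y = w (j + k)"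
        using w_surj by blast
      consider "k = 0" | "0 < k" "k \<le> i" | "i < k" by linarith
      then show "y \<in> insert u S"
      proof cases
        case 1
        then show ?thesis using k j by simp
      next
        case 2
        then show ?thesis using down[of "i - k"] k by simp
      next
        case 3
        then show ?thesis using up[of "k - i"] k by simp
      qed
    qed
  qed
qed

text \<open>A longest \<open>F\<close>-path closes up: both neighbours of its first vertex lie on
  it, and the one that is not second must be last, since at an inner position it would have three
  \<open>F\<close>-neighbours. The cycle obtained is closed under \<open>F\<close>, hence
  spanning.\<close>

lemma two_regular_connected_hamilton:
  assumes G: "simple_graph G" "verts G \<noteq> {}" and F: "two_regular (verts G) F" "\<And>x y. F x y \<Longrightarrow> y \<in> nb G x"
    and conn: "\<And>S. S \<subseteq> verts G \<Longrightarrow> S \<noteq> {} \<Longrightarrow> (\<And>x y. x \<in> S \<Longrightarrow> F x y \<Longrightarrow> y \<in> S) \<Longrightarrow> S = verts G"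
  shows "has_hamilton_cycle G"
proof -
  let ?path = "\<lambda>xs. xs \<noteq> [] \<and> distinct xs \<and> set xs \<subseteq> verts G \<and> successively F xs"
  have fin: "finite (verts G)"
    using G unfolding simple_graph_def by blast
  obtain v where "v \<in> verts G"
    using G by blast
  then have "?path [v]" by simp
  moreover have "\<forall>xs. ?path xs \<longrightarrow> length xs < Suc (card (verts G))"
    using fin by (metis card_mono distinct_card le_imp_less_Suc)
  ultimately obtain xs where xs: "?path xs" and max: "\<And>ys. ?path ys \<Longrightarrow> length ys \<le> length xs"
    using ex_has_greatest_nat[of ?path "[v]" length "Suc (card (verts G))"] by blast
  define n where "n = length xs"
  have n0: "0 < n" using xs by (simp add: n_def)
  have inV: "xs ! i \<in> verts G" if "i < n" for i
    using xs that by (auto simp: n_def)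
  have step: "F (xs ! i) (xs ! Suc i)" if "Suc i < n" for i
    using xs that by (simp add: n_def successively_conv_nth)
  have symF: "F x y \<Longrightarrow> F y x" for x y
    using F(1) unfolding two_regular_def by (meson sympD)
  have idx: "xs ! i = xs ! j \<longleftrightarrow> i = j" if "i < n" "j < n" for i j
    using xs that by (simp add: n_def nth_eq_iff_index_eq)
  have irr: "\<not> F x x" for x
    using F(2) nb_irrefl[OF G(1)] by blast
  have hd_nbs: "\<exists>i<n. i \<noteq> 0 \<and> y = xs ! i" if "F (xs ! 0) y" for y
  proof -
    have "y \<in> set xs"
    proof (rule ccontr)
      assume "y \<notin> set xs"
      moreover have "y \<in> verts G"
        using that F(2) nb_subset[OF G(1)] by blast
      moreover have "successively F (y # xs)"
        using xs symF[OF that] by (simp add: successively_Cons hd_conv_nth)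
      ultimately have "?path (y # xs)" using xs by simp
      then show False using max by fastforce
    qed
    then obtain i where "i < n" "y = xs ! i"
      unfolding n_def by (metis in_set_conv_nth)
    then show ?thesis
      using that irr by metis
  qed
  have "card {y. F (xs ! 0) y} = 2"
    using F(1) inV n0 unfolding two_regular_def by blast
  then obtain a b where ab: "a \<noteq> b" "F (xs ! 0) a" "F (xs ! 0) b"
    by (metis (mono_tags, lifting) card_2_iff insertCI mem_Collect_eq)
  obtain i j where ij: "i < n" "i \<noteq> 0" "a = xs ! i" "j < n" "j \<noteq> 0" "b = xs ! j"
    using hd_nbs ab by metis
  then have "i \<noteq> j" using ab by blast
  \<comment> \<open>Of two distinct nonzero positions, the larger is at least 2.\<close>
  then obtain k where k: "k < n" "2 \<le> k" "F (xs ! 0) (xs ! k)"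
    using ij ab by (cases "i < j") (metis (no_types) One_nat_def Suc_leI not_less_eq_eq
        le_neq_implies_less less_Suc_eq_le not_gr0 numeral_2_eq_2 nat_neq_iff)+
  have "Suc k = n"
  proof (rule ccontr)
    assume "Suc k \<noteq> n"
    then have "F (xs ! k) (xs ! Suc k)" "F (xs ! k) (xs ! (k - 1))"
      using step[of k] symF[OF step[of "k - 1"]] k by auto
    then have "xs ! 0 = xs ! Suc k \<or> xs ! 0 = xs ! (k - 1)"
      using two_regular_third[OF F(1) inV[OF k(1)]] idx[of "Suc k" "k - 1"] k symF
        \<open>Suc k \<noteq> n\<close> by auto
    then show False
      using idx[OF n0, of "Suc k"] idx[OF n0, of "k - 1"] k \<open>Suc k \<noteq> n\<close> by linarith
  qed
  then have n3: "3 \<le> n" and last: "F (xs ! (n - 1)) (xs ! 0)"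
    using k symF by auto
  have next1: "F (xs ! i) (xs ! (Suc i mod n))" if "i < n" for i
    using that last step[of i] by (cases "Suc i = n") auto
  have prev: "F (xs ! i) (xs ! (if i = 0 then n - 1 else i - 1))" if "i < n" for i
    using that symF[OF last] symF[OF step[of "i - 1"]] by auto
  have "set xs = verts G"
  proof (rule conn)
    show "set xs \<subseteq> verts G" "set xs \<noteq> {}" using xs by auto
    fix x y assume "x \<in> set xs" and y: "F x y"
    then obtain i where i: "i < n" "x = xs ! i"
      unfolding n_def by (metis in_set_conv_nth)
    let ?p = "if i = 0 then n - 1 else i - 1" and ?s = "Suc i mod n"
    have lt: "?s < n" "?p < n" using i n3 by auto
    have "?s \<noteq> ?p"
      using i n3 by (cases "Suc i = n") auto
    then have "y = xs ! ?s \<or> y = xs ! ?p"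
      using two_regular_third[OF F(1) inV[OF i(1)] next1[OF i(1)] prev[OF i(1)]] idx[OF lt] y i
      by blast
    with lt show "y \<in> set xs"
      by (metis n_def nth_mem)
  qed
  moreover have "is_cycle G xs"
    unfolding is_cycle_def
    using xs n3 next1 F(2) unfolding n_def nb_def by blast
  ultimately show ?thesis
    unfolding has_hamilton_cycle_def by blast
qed

section \<open>Hamiltonicity as a local property\<close>

lemma third_element:
  assumes "card A = 3" "x \<in> A" "y \<in> A" "x \<noteq> y"
  obtains z where "A = {x, y, z}" "z \<noteq> x" "z \<noteq> y"
proof -
  have "card (A - {x, y}) = 1"
    using assms by (subst card_Diff_subset) auto
  then obtain z where "A - {x, y} = {z}"
    by (meson card_1_singletonE)
  then show ?thesis
    using that[of z] assms by blast
qed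

text \<open>Each end of the edge has two further neighbours. If the two pairs were disjoint, they
  would form \<open>graph_H1\<close> together with the edge as its middle edge.\<close>

lemma H1_free_common_neighbour:
  assumes G: "simple_graph G" "subgraph_free graph_H1 G"
    and uv: "v \<in> nb G u" "card (nb G u) = 3" "card (nb G v) = 3"
  obtains p where "p \<in> nb G u" "p \<in> nb G v"
proof -
  have vu: "u \<in> nb G v" "u \<noteq> v"
    using uv nb_sym nb_irrefl[OF G(1)] by metis+
  have "2 \<le> card (nb G u - {v})" "2 \<le> card (nb G v - {u})"
    using uv vu by (simp_all add: finite_nb[OF G(1)])
  then obtain a b c d where ab: "a \<in> nb G u - {v}" "b \<in> nb G u - {v}" "a \<noteq> b"
    and cd: "c \<in> nb G v - {u}" "d \<in> nb G v - {u}" "c \<noteq> d"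
    by (metis two_elements)
  have "a \<noteq> u" "b \<noteq> u" "c \<noteq> v" "d \<noteq> v"
    using ab cd nb_irrefl[OF G(1)] by fastforce+
  with ab cd vu uv(1) H1_present[OF G(1), of u v a b c d] G(2) show ?thesis
    using that by fastforce
qed

text \<open>A copy of \<open>graph_H1\<close> with middle edge \<open>u v\<close> arises once two
  neighbours \<open>c, d\<close> of \<open>v\<close> leave two neighbours of \<open>u\<close>
  outside \<open>{v, c, d}\<close>. If \<open>c\<close> is not adjacent to \<open>u\<close>, it
  takes none of the four away; with degree at least 5, every choice leaves two.\<close>

lemma H1_free_large_degree:
  assumes G: "simple_graph G" "subgraph_free graph_H1 G"
    and uv: "v \<in> nb G u" "4 \<le> card (nb G u)" "3 \<le> card (nb G v)"
  shows "nb G v \<subseteq> insert u (nb G u)" "card (nb G u) = 4"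
proof -
  have vu: "u \<in> nb G v" "u \<noteq> v"
    using uv nb_sym nb_irrefl[OF G(1)] by metis+
  have no: "False" if cd: "c \<in> nb G v - {u}" "d \<in> nb G v - {u}" "c \<noteq> d"
    and card: "2 \<le> card (nb G u - {v, c, d})" for c d
  proof -
    obtain a b where ab: "a \<in> nb G u - {v, c, d}" "b \<in> nb G u - {v, c, d}" "a \<noteq> b"
      using two_elements[OF card] by blast
    have "a \<noteq> u" "b \<noteq> u" "c \<noteq> v" "d \<noteq> v"
      using ab cd nb_irrefl[OF G(1)] by fastforce+
    with ab cd vu uv(1) H1_present[OF G(1), of u v a b c d] G(2) show False
      by fastforce
  qed
  have two: "2 \<le> card (nb G v - {u})"
    using uv vu by simp
  show "nb G v \<subseteq> insert u (nb G u)"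
  proof
    fix c assume c: "c \<in> nb G v"
    show "c \<in> insert u (nb G u)"
    proof (rule ccontr)
      assume nc: "c \<notin> insert u (nb G u)"
      obtain d where d: "d \<in> nb G v - {u}" "d \<noteq> c"
        using two_elements[OF two] by metis
      have "card (nb G u) - card {v, d} \<le> card (nb G u - {v, d})"
        by (rule diff_card_le_card_Diff) simp
      moreover have "card {v, d} \<le> 2"
        by (simp add: card_insert_if)
      ultimately have "2 \<le> card (nb G u - {v, d})"
        using uv(2) by linarith
      moreover have "nb G u - {v, c, d} = nb G u - {v, d}"
        using nc by blast
      ultimately have "2 \<le> card (nb G u - {v, c, d})"
        by (simp only:)
      then show False
        using no[of c d] c nc d by blast
    qed
  qed
  show "card (nb G u) = 4"
  proof (rule ccontr)
    assume "card (nb G u) \<noteq> 4"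
    obtain c d where cd: "c \<in> nb G v - {u}" "d \<in> nb G v - {u}" "c \<noteq> d"
      by (rule two_elements[OF two])
    have "card (nb G u) - card {v, c, d} \<le> card (nb G u - {v, c, d})"
      by (rule diff_card_le_card_Diff) simp
    moreover have "card {v, c, d} \<le> 3"
      by (simp add: card_insert_if)
    ultimately show False
      using no[OF cd] uv(2) \<open>card (nb G u) \<noteq> 4\<close> by linarith
  qed
qed

text \<open>The arguments are the ends of the edge that a Hamilton cycle of a larger graph bypasses
  through \<open>p\<close>.\<close>

definition ear :: "'a ugraph \<Rightarrow> 'a \<Rightarrow> 'a \<Rightarrow> bool" where
  "ear G u v \<longleftrightarrow> v \<in> nb G u \<and> card (nb G u) = 3 \<and> card (nb G v) = 3 \<and>
     (\<exists>p. p \<in> nb G u \<and> p \<in> nb G v \<and> card (nb G p) = 2)"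

text \<open>\<open>u v\<close> is the central edge, \<open>p\<close> and \<open>b\<close> are the
  outer vertices. An edge from \<open>p\<close> to \<open>b\<close> is not forbidden here; K4 is
  excluded later by connectivity and size.\<close>

definition diamond :: "'a ugraph \<Rightarrow> 'a \<Rightarrow> 'a \<Rightarrow> 'a \<Rightarrow> 'a \<Rightarrow> bool" where
  "diamond G u v p b \<longleftrightarrow> v \<in> nb G u \<and> p \<in> nb G u \<and> p \<in> nb G v \<and> b \<in> nb G u \<and> b \<in> nb G v \<and> p \<noteq> b \<and>
     card (nb G u) = 3 \<and> card (nb G v) = 3 \<and> card (nb G p) = 3 \<and> card (nb G b) = 3"

definition locally_traversable :: "'a ugraph \<Rightarrow> 'a \<Rightarrow> bool" where
  "locally_traversable G x \<longleftrightarrow> card (nb G x) = 2 \<or>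
     card (nb G x) = 3 \<and> ((\<exists>v. ear G x v) \<or> (\<exists>u v p b. diamond G u v p b \<and> x \<in> {u, v, p, b}))"

section \<open>Necessity: what a Hamilton cycle forces\<close>

lemma hamilton_cycle_traversable:
  assumes G: "simple_graph G" "subgraph_free graph_H1 G" "6 \<le> card (verts G)"
    and ham: "has_hamilton_cycle G"
  shows "graph_connected G \<and> (\<forall>x\<in>verts G. locally_traversable G x)"
proof -
  obtain F where F: "two_regular (verts G) F" and Fnb: "\<And>x y. F x y \<Longrightarrow> y \<in> nb G x"
    and cut: "\<And>u S. u \<in> verts G \<Longrightarrow> S \<subseteq> verts G \<Longrightarrow> u \<notin> S \<Longrightarrow> S \<noteq> {} \<Longrightarrow>
       (\<And>x y. x \<in> S \<Longrightarrow> F x y \<Longrightarrow> y \<in> insert u S) \<Longrightarrow> verts G \<subseteq> insert u S"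
    using hamilton_cycle_2_factor[OF G(1) ham] by blast
  note fin = finite_nb[OF G(1)] and sub = nb_subset[OF G(1)] and irr = nb_irrefl[OF G(1)]
  have small: "\<not> verts G \<subseteq> A" if "finite A" "card A \<le> 5" for A
    using that G(3) card_mono[OF that(1), of "verts G"] by linarith
  have symF: "F x y \<Longrightarrow> F y x" for x y
    using F unfolding two_regular_def by (meson sympD)
  have cF: "card {y. F x y} = 2" if "x \<in> verts G" for x
    using F that unfolding two_regular_def by blast
  have FS: "{y. F x y} \<subseteq> nb G x" for x
    using Fnb by blast
  have ge2: "2 \<le> card (nb G x)" if "x \<in> verts G" for x
    using cF[OF that] card_mono[OF fin FS] by metis
  have forced: "F x y" if "card (nb G x) = 2" "y \<in> nb G x" for x y
  proof -
    have "x \<in> verts G"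
      using that sub nb_sym by (metis subsetD)
    then have "{y. F x y} = nb G x"
      using cF that(1) card_subset_eq[OF fin FS] by metis
    with that show ?thesis by blast
  qed
  \<comment> \<open>If all neighbours had degree 2, every edge at \<open>x\<close> would be forced,
    giving \<open>x\<close> at least three \<open>F\<close>-neighbours.\<close>
  have ex3: "\<exists>v \<in> nb G x. 3 \<le> card (nb G v)" if x: "x \<in> verts G" "3 \<le> card (nb G x)" for x
  proof (rule ccontr)
    assume no: "\<not> ?thesis"
    have "F x y" if "y \<in> nb G x" for y
    proof -
      have "y \<in> verts G" using that sub by blast
      then have "card (nb G y) = 2"
        using ge2 no that by (metis Suc_leI le_neq_implies_less eval_nat_numeral(3))
      then show ?thesis
        using forced that symF nb_sym by metis
    qed
    then have "{y. F x y} = nb G x"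
      using Fnb by blast
    with x cF show False by fastforce
  qed
  have le3: "card (nb G u) \<le> 3" if u: "u \<in> verts G" for u
  proof (rule ccontr)
    assume "\<not> ?thesis"
    then have u4: "4 \<le> card (nb G u)" by simp
    then obtain v where v: "v \<in> nb G u" "3 \<le> card (nb G v)"
      using ex3[OF u] by auto
    \<comment> \<open>The neighbours of \<open>u\<close> that see nothing beyond the closed
      neighbourhood of \<open>u\<close>. \<open>F\<close> leaves this set only towards
      \<open>u\<close>, so \<open>cut\<close> confines the whole graph to at most five
      vertices.\<close>
    define S where "S = {y \<in> nb G u. nb G y \<subseteq> insert u (nb G u)}"
    have "verts G \<subseteq> insert u S"
    proof (rule cut[OF u])
      show "S \<subseteq> verts G" "u \<notin> S"
        using sub irr unfolding S_def by blast+
      show "S \<noteq> {}"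
        using v H1_free_large_degree(1)[OF G(1,2) v(1) u4 v(2)] unfolding S_def by blast
      fix y z assume y: "y \<in> S" and "F y z"
      then have z: "z \<in> nb G y" "z \<in> insert u (nb G u)"
        using Fnb unfolding S_def by blast+
      show "z \<in> insert u S"
      proof (cases "z = u")
        case False
        then have zu: "z \<in> nb G u" using z by blast
        have "nb G z \<subseteq> insert u (nb G u)"
        proof (cases "3 \<le> card (nb G z)")
          case True
          then show ?thesis
            using H1_free_large_degree(1)[OF G(1,2) zu u4] by blast
        next
          \<comment> \<open>With degree at most 2, the two known neighbours \<open>u\<close> and
            \<open>y\<close> of \<open>z\<close> are the only ones.\<close>
          case False
          moreover have "{u, y} \<subseteq> nb G z" "u \<noteq> y"
            using z zu nb_sym irr y unfolding S_def by (metis empty_subsetI insert_subset, metis mem_Collect_eq)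
          moreover have "card {u, y} = 2"
            using \<open>u \<noteq> y\<close> by simp
          ultimately have "nb G z = {u, y}"
            using card_seteq[OF fin, of "{u, y}" z] by simp
          with y show ?thesis unfolding S_def by blast
        qed
        with zu show ?thesis unfolding S_def by blast
      qed simp
    qed
    then have "verts G \<subseteq> insert u (nb G u)"
      unfolding S_def by blast
    moreover have "card (insert u (nb G u)) \<le> 5"
      using H1_free_large_degree(2)[OF G(1,2) v(1) u4 v(2)] fin irr by simp
    ultimately show False
      using small fin by blast
  qed
  \<comment> \<open>By \<open>cut\<close>, a closed set missing \<open>u\<close> contains all other
    vertices, among them a neighbour of \<open>u\<close>, and so it would contain
    \<open>u\<close>.\<close>
  have "graph_connected G"
    unfolding graph_connected_def
  proof (intro allI impI)
    fix S assume S: "S \<subseteq> verts G" "S \<noteq> {}" "\<forall>x\<in>S. nb G x \<subseteq> S"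
    show "S = verts G"
    proof (rule ccontr)
      assume "S \<noteq> verts G"
      then obtain u where u: "u \<in> verts G" "u \<notin> S" using S by blast
      then have V: "verts G \<subseteq> insert u S"
        using S Fnb by (intro cut) blast+
      obtain y where "y \<in> nb G u"
        using ge2[OF u(1)] by fastforce
      then have "y \<in> S" "u \<in> nb G y"
        using V sub irr nb_sym by fast+
      then show False using S u by blast
    qed
  qed
  moreover have "locally_traversable G u" if u: "u \<in> verts G" for u
  proof (cases "card (nb G u) = 2")
    case False
    then have u3: "card (nb G u) = 3"
      using ge2[OF u] le3[OF u] by linarith
    have deg: "card (nb G x) = 2 \<or> card (nb G x) = 3" if "x \<in> nb G y" for x y
    proof -
      have "x \<in> verts G" using that sub by blast
      then show ?thesis
        using ge2[of x] le3[of x] by linarith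
    qed
    obtain v where v: "v \<in> nb G u" "card (nb G v) = 3"
      using ex3[OF u] u3 deg by fastforce
    obtain p where p: "p \<in> nb G u" "p \<in> nb G v"
      using H1_free_common_neighbour[OF G(1,2) v(1) u3 v(2)] by blast
    have "(\<exists>v. ear G u v) \<or> (\<exists>u' v p b. diamond G u' v p b \<and> u \<in> {u', v, p, b})"
    proof (cases "card (nb G p) = 2")
      case True
      then show ?thesis
        using v p u3 unfolding ear_def by blast
    next
      case False
      then have p3: "card (nb G p) = 3" using deg p by blast
      have ne: "u \<noteq> v" "u \<noteq> p" "v \<noteq> p" using v p irr by metis+
      have rev: "u \<in> nb G v" "u \<in> nb G p" "v \<in> nb G p"
        using v p nb_sym by metis+
      obtain b where b: "nb G u = {v, p, b}" "b \<noteq> v" "b \<noteq> p"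
        using third_element[OF u3 v(1) p(1) ne(3)] by metis
      obtain c where c: "nb G v = {u, p, c}" "c \<noteq> u" "c \<noteq> p"
        using third_element[OF v(2) rev(1) p(2) ne(2)] by metis
      obtain d where d: "nb G p = {u, v, d}" "d \<noteq> u" "d \<noteq> v"
        using third_element[OF p3 rev(2,3) ne(1)] by metis
      have in_nb: "b \<in> nb G u" "c \<in> nb G v" "d \<in> nb G p"
        using b c d by auto
      show ?thesis
      \<comment> \<open>\<open>b\<close>, \<open>c\<close>, \<open>d\<close> are the outside
        neighbours of the three corners. A coincidence yields an ear or a diamond; if all differ,
        parity gives a contradiction.\<close>
      proof (cases "b = c \<or> b = d \<or> c = d")
        case True
        then consider "b = c" | "b = d" | "c = d" by blast
        then show ?thesis
        proof cases
          case 1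
          then show ?thesis
            using deg[OF in_nb(1)] u3 v p p3 b c unfolding ear_def diamond_def by blast
        next
          case 2
          then show ?thesis
          proof -
            have "b \<in> nb G p" using 2 in_nb(3) by simp
            then have "card (nb G b) = 2 \<Longrightarrow> ear G u p" "card (nb G b) = 3 \<Longrightarrow> diamond G u p v b"
              using in_nb(1) u3 v p p3 b rev unfolding ear_def diamond_def by blast+
            then show ?thesis
              using deg[OF in_nb(1)] by blast
          qed
        next
          case 3
          \<comment> \<open>An ear on \<open>v p\<close> would not serve \<open>u\<close>, so degree
            2 must be excluded: \<open>{v, p, c}\<close> would be joined to the rest only through
            \<open>u\<close>, and the graph would have four vertices. With degree 3,
            \<open>u\<close> is an outer vertex of a diamond.\<close>
          have "card (nb G c) = 3"
          proof (rule ccontr)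
            assume "card (nb G c) \<noteq> 3"
            then have c2: "card (nb G c) = 2"
              using deg in_nb by blast
            have "{v, p} \<subseteq> nb G c"
              using in_nb 3 nb_sym by (metis empty_subsetI insert_subset)
            then have nc: "nb G c = {v, p}"
              using card_subset_eq[OF fin, of "{v, p}" c] c2 ne by simp
            have "verts G \<subseteq> insert u {v, p, c}"
            proof (rule cut[OF u])
              show "{v, p, c} \<subseteq> verts G"
                using v p in_nb sub by blast
              show "u \<notin> {v, p, c}" using ne c by blast
            next
              fix x y assume "x \<in> {v, p, c}" "F x y"
              then show "y \<in> insert u {v, p, c}"
                using Fnb[of x y] c d nc 3 by auto
            qed simp
            moreover have "card {u, v, p, c} \<le> 5"
              by (simp add: card_insert_if)
            moreover have "finite {u, v, p, c}"
              by simp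
            ultimately show False
              using small by metis
          qed
          moreover have "c \<in> nb G p"
            using 3 in_nb(3) by simp
          ultimately have "diamond G v p u c"
            using v(2) p p3 u3 rev in_nb(2) c(2) unfolding diamond_def by blast
          then show ?thesis by blast
        qed
      next
        case False
        \<comment> \<open>An edge in no triangle with one end of degree 3 has its other end of
          degree 2, by \<open>H1_free_common_neighbour\<close>, and is therefore forced.\<close>
        have pend: "F x y" if x: "x \<in> verts G" "card (nb G x) = 3" "y \<in> nb G x"
          and none: "\<And>q. q \<in> nb G x \<Longrightarrow> q \<notin> nb G y" for x y
        proof -
          have "card (nb G y) = 2"
            using deg[OF x(3)] H1_free_common_neighbour[OF G(1,2) x(3,2)] none by blast
          then show ?thesis
            using forced symF nb_sym x(3) by metis
        qed
        have bcd: "b \<noteq> u" "c \<noteq> v" "d \<noteq> p"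
          using in_nb irr by metis+
        have Fub: "F u b"
        proof (rule pend[OF u u3 in_nb(1)])
          show "q \<notin> nb G b" if "q \<in> nb G u" for q
          proof -
            have "b \<notin> nb G v" "b \<notin> nb G p" "b \<notin> nb G b"
              using False bcd b c d irr by auto
            moreover have "q \<in> {v, p, b}"
              using that b(1) by simp
            ultimately show ?thesis
              using nb_sym[of q G b] by blast
          qed
        qed
        have Fvc: "F v c"
        proof (rule pend)
          show "q \<notin> nb G c" if "q \<in> nb G v" for q
          proof -
            have "c \<notin> nb G u" "c \<notin> nb G p" "c \<notin> nb G c"
              using False bcd b c d irr by auto
            moreover have "q \<in> {u, p, c}"
              using that c(1) by simp
            ultimately show ?thesis
              using nb_sym[of q G c] by blast
          qed
          show "v \<in> verts G" using v sub by blast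
        qed (use v in_nb in auto)
        have Fpd: "F p d"
        proof (rule pend)
          show "q \<notin> nb G d" if "q \<in> nb G p" for q
          proof -
            have "d \<notin> nb G u" "d \<notin> nb G v" "d \<notin> nb G d"
              using False bcd b c d irr by auto
            moreover have "q \<in> {u, v, d}"
              using that d(1) by simp
            ultimately show ?thesis
              using nb_sym[of q G d] by blast
          qed
          show "p \<in> verts G" using p sub by blast
        qed (use p3 in_nb in auto)
        have one: "F x y \<noteq> F x z" if "nb G x = {y, z, w}" "F x w" "y \<noteq> z" "w \<noteq> y" "w \<noteq> z"
            "x \<in> verts G" for x y z w
        proof -
          have sub: "{a. F x a} \<subseteq> {y, z, w}"
            using Fnb that(1) by blast
          have w: "F x w" using that by blast
          show ?thesis
          proof
            assume eq: "F x y = F x z"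
            have "{a. F x a} = (if F x y then {y, z, w} else {w})"
              using sub w eq by auto
            then have "card (if F x y then {y, z, w} else {w}) = 2"
              using cF that(6) by metis
            then show False
              using that(3-5) by (simp split: if_splits)
          qed
        qed
        have "v \<in> verts G" "p \<in> verts G" using v p sub by blast+
        then have "F v u \<noteq> F v p" "F p u \<noteq> F p v"
          using one[OF c(1) Fvc] one[OF d(1) Fpd] c d ne by metis+
        moreover have "F u v \<noteq> F u p"
          using one[OF b(1) Fub] b ne u by metis
        \<comment> \<open>By symmetry of \<open>F\<close>, the three triangle edges carry truth
          values that would differ pairwise.\<close>
        ultimately show ?thesis using symF by blast
      qed
    qed
    with u3 show ?thesis unfolding locally_traversable_def by blast
  qed (simp add: locally_traversable_def)
  ultimately show ?thesis by blast
qed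

section \<open>Sufficiency: deleting one edge at each vertex of degree 3\<close>

lemma ear_sym: "ear G u v \<Longrightarrow> ear G v u"
  unfolding ear_def using nb_sym[of v G u] by blast

lemma diamond_swap:
  assumes "diamond G u v p b"
  shows "diamond G v u p b" "diamond G u v b p"
  using assms nb_sym[of v G u] unfolding diamond_def by blast+

text \<open>The linear order serves to label each diamond in a single way, which makes the choice of
  deleted sides canonical.\<close>

locale traversable_graph =
  fixes G :: "'a :: linorder ugraph"
  assumes simple: "simple_graph G" and connected: "graph_connected G"
    and large: "6 \<le> card (verts G)"
    and traversable: "\<And>x. x \<in> verts G \<Longrightarrow> locally_traversable G x"
begin

lemmas fin = finite_nb[OF simple] and irr = nb_irrefl[OF simple] and sub = nb_subset[OF simple]

text \<open>The outer vertices are not adjacent: otherwise the four vertices would be a K4 with no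
  further edges, hence the whole graph, against its size.\<close>

lemma diamond_nbs:
  assumes "diamond G u v p b"
  shows "nb G u = {v, p, b}" "nb G v = {u, p, b}" "distinct [u, v, p, b]" "p \<notin> nb G b"
    "\<exists>z. nb G p = {u, v, z}" "\<exists>z. nb G b = {u, v, z}"
proof -
  note d = assms[unfolded diamond_def]
  have rev: "u \<in> nb G v" "u \<in> nb G p" "v \<in> nb G p" "u \<in> nb G b" "v \<in> nb G b"
    using d nb_sym by metis+
  show dist: "distinct [u, v, p, b]"
    using d rev irr by auto
  show nbs: "nb G u = {v, p, b}" "nb G v = {u, p, b}"
    using d rev dist by (intro card_subset_eq[symmetric, OF fin]; simp)+
  show ex: "\<exists>z. nb G p = {u, v, z}" "\<exists>z. nb G b = {u, v, z}"
    using d rev dist by (metis distinct_length_2_or_more third_element)+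
  show "p \<notin> nb G b"
  proof
    assume pb: "p \<in> nb G b"
    then have "nb G b = {u, v, p}" "nb G p = {u, v, b}"
      using ex dist nb_sym[of p G b] by auto
    then have "\<forall>x\<in>{u, v, p, b}. nb G x \<subseteq> {u, v, p, b}"
      using nbs by auto
    moreover have "{u, v, p, b} \<subseteq> verts G"
      using rev(1) sub[of v] sub[of u] nbs by blast
    ultimately have "{u, v, p, b} = verts G"
      using connected unfolding graph_connected_def by blast
    moreover have "card {u, v, p, b} \<le> 4"
      by (simp add: card_insert_if)
    ultimately show False
      using large by simp
  qed
qed

text \<open>Two ears at \<open>x\<close> would have different vertices \<open>p\<close>,
  \<open>q\<close> of degree 2, and \<open>x\<close> would have the four neighbours
  \<open>y, z, p, q\<close>.\<close>

lemma ear_unique: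
  assumes "ear G x y" "ear G x z"
  shows "y = z"
proof (rule ccontr)
  assume "y \<noteq> z"
  obtain p q where p: "p \<in> nb G x" "p \<in> nb G y" "card (nb G p) = 2"
    and q: "q \<in> nb G x" "q \<in> nb G z" "card (nb G q) = 2"
    using assms unfolding ear_def by blast
  have x: "y \<in> nb G x" "z \<in> nb G x" "card (nb G x) = 3" "card (nb G y) = 3" "card (nb G z) = 3"
    using assms unfolding ear_def by blast+
  have xyz: "x \<noteq> y" "x \<noteq> z"
    using x irr by blast+
  have "nb G p = {x, y}" "nb G q = {x, z}"
    using p q nb_sym[of x G p] nb_sym[of y G p] nb_sym[of x G q] nb_sym[of z G q] xyz
    by (intro card_subset_eq[symmetric, OF fin]; simp)+
  then have "p \<noteq> q"
    using \<open>y \<noteq> z\<close> xyz by (metis doubleton_eq_iff)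
  moreover have "p \<noteq> y" "p \<noteq> z" "q \<noteq> y" "q \<noteq> z"
    using p q x by auto
  ultimately have "card {y, z, p, q} = 4"
    using \<open>y \<noteq> z\<close> by simp
  moreover have "card {y, z, p, q} \<le> card (nb G x)"
    using p q x by (intro card_mono fin) simp
  ultimately show False
    using x by simp
qed

text \<open>The degree-2 vertex \<open>q\<close> of the ear lies outside the diamond, so
  \<open>x\<close> is an outer vertex and \<open>y\<close> a central one; but a central vertex has
  all its neighbours inside.\<close>

lemma ear_not_in_diamond:
  assumes "diamond G u v p b" "x \<in> {u, v, p, b}"
  shows "\<not> ear G x y"
proof
  assume "ear G x y"
  then obtain q where q: "q \<in> nb G x" "q \<in> nb G y" "card (nb G q) = 2"
    and y: "y \<in> nb G x" "card (nb G y) = 3"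
    unfolding ear_def by blast
  have d: "card (nb G z) = 3" if "z \<in> {u, v, p, b}" for z
    using assms(1) that unfolding diamond_def by blast
  have q': "q \<notin> {u, v, p, b}" using d q by fastforce
  have "y \<in> {u, v}"
    using assms(2) q q' y diamond_nbs[OF assms(1)] by auto
  then show False
    using q q' diamond_nbs[OF assms(1)] by auto
qed

text \<open>Since the outer vertices are not adjacent, \<open>v\<close> is determined as the
  neighbour of \<open>u\<close> that is adjacent to both others.\<close>

lemma diamond_common_centre:
  assumes D: "diamond G u v p b" "diamond G u v' p' b'"
  shows "v = v' \<and> {p, b} = {p', b'}"
proof -
  note n = diamond_nbs[OF D(1)] and n' = diamond_nbs[OF D(2)]
  have "v' \<in> {v, p, b}" using n n' by auto
  moreover have "v' \<noteq> p" "v' \<noteq> b"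
    using n n' nb_sym[of p G b] by auto
  ultimately have "v = v'" by blast
  moreover have "{p, b} = nb G u - {v}" "{p', b'} = nb G u - {v'}"
    using n(1,3) n'(1,3) by auto
  ultimately show ?thesis by simp
qed

lemma diamond_common_centres:
  assumes "diamond G u v p b" "diamond G u' v' p' b'" "{u, v} \<inter> {u', v'} \<noteq> {}"
  shows "{u, v} = {u', v'} \<and> {p, b} = {p', b'}"
  using assms diamond_swap(1)[OF assms(1)] diamond_swap(1)[OF assms(2)] diamond_common_centre
  by (smt (verit) disjoint_iff insert_commute insert_iff singleton_iff)

text \<open>The edge \<open>u' v'\<close> lies inside the neighbourhood \<open>{v, p, b}\<close> of
  \<open>u\<close>, hence contains \<open>v\<close>. So \<open>b'\<close> is a neighbour of
  \<open>v\<close> and thereby of \<open>u\<close>, although \<open>u\<close> and \<open>b'\<close>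
  are the outer vertices of the second diamond.\<close>

lemma diamond_centre_not_end:
  assumes D: "diamond G u v p b" "diamond G u' v' u b'"
  shows False
proof -
  note n = diamond_nbs[OF D(1)] and n' = diamond_nbs[OF D(2)]
  have "u' \<in> {v, p, b}" "v' \<in> {v, p, b}" "v' \<in> nb G u'" "v' \<noteq> u'"
    using n' n(1) nb_sym[of u' G u] nb_sym[of v' G u] by auto
  then have "v \<in> {u', v'}"
    using n(4) nb_sym[of p G b] by auto
  then have "b' \<in> nb G v"
    using n' by auto
  then have "b' \<in> nb G u"
    using n n' by auto
  then show False
    using n'(4) nb_sym[of b' G u] by simp
qed

lemma diamond_unique:
  assumes D: "diamond G u v p b" "diamond G u' v' p' b'"
    and x: "x \<in> {u, v, p, b}" "x \<in> {u', v', p', b'}"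
  shows "{u, v} = {u', v'} \<and> {p, b} = {p', b'}"
proof -
  have ends: "x \<notin> {p', b'}" if "x \<in> {u, v}" "diamond G u v p b" "diamond G u' v' p' b'"
    for u v p b u' v' p' b'
    using that diamond_swap diamond_centre_not_end by (metis insertE singletonD)
  consider "x \<in> {u, v}" "x \<in> {u', v'}" | "x \<in> {p, b}" "x \<in> {p', b'}"
    using ends D x by blast
  then show ?thesis
  proof cases
    case 1
    then show ?thesis
      using diamond_common_centres[OF D] by blast
  next
    case 2
    then obtain z z' where "nb G x = {u, v, z}" "nb G x = {u', v', z'}"
      using diamond_nbs(5,6)[OF D(1)] diamond_nbs(5,6)[OF D(2)] by blast
    moreover have "u \<noteq> v" "u' \<noteq> v'"
      using diamond_nbs(3)[OF D(1)] diamond_nbs(3)[OF D(2)] by auto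
    \<comment> \<open>Two pairs inside a set of at most three vertices meet.\<close>
    ultimately have "{u, v} \<inter> {u', v'} \<noteq> {}"
      by (smt (verit) disjoint_iff insert_iff singleton_iff)
    then show ?thesis
      using diamond_common_centres[OF D] by blast
  qed
qed

text \<open>The edges left out of the Hamilton cycle: the edge of an ear that is bypassed by its vertex of
  degree 2, and two disjoint sides of each diamond, chosen by means of the order so that the other
  edges of the diamond form the path \<open>p, u, v, b\<close>.\<close>

definition skipped :: "'a \<Rightarrow> 'a \<Rightarrow> bool" where
  "skipped x y \<longleftrightarrow> ear G x y \<or> (\<exists>u v p b. diamond G u v p b \<and> u < v \<and> p < b \<and>
     ((x, y) = (p, v) \<or> (x, y) = (v, p) \<or> (x, y) = (u, b) \<or> (x, y) = (b, u)))"

definition kept :: "'a \<Rightarrow> 'a \<Rightarrow> bool" where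
  "kept x y \<longleftrightarrow> y \<in> nb G x \<and> \<not> skipped x y"

lemma skipped_sym: "skipped x y \<Longrightarrow> skipped y x"
  unfolding skipped_def using ear_sym by fast

lemma kept_sym: "kept x y \<Longrightarrow> kept y x"
  unfolding kept_def using skipped_sym nb_sym by metis

lemma skipped_nb: "skipped x y \<Longrightarrow> y \<in> nb G x \<and> card (nb G x) = 3 \<and> card (nb G y) = 3"
  unfolding skipped_def ear_def diamond_def using nb_sym[of _ G] by blast

lemma skipped_unique:
  assumes "skipped x y" "skipped x z"
  shows "y = z"
proof (cases "\<exists>w. ear G x w")
  case True
  then have "ear G x y" "ear G x z"
    using assms ear_not_in_diamond unfolding skipped_def by blast+
  then show ?thesis by (rule ear_unique)
next
  case False
  obtain u v p b where D: "diamond G u v p b" "u < v" "p < b"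
    and y: "(x, y) = (p, v) \<or> (x, y) = (v, p) \<or> (x, y) = (u, b) \<or> (x, y) = (b, u)"
    using assms(1) False unfolding skipped_def by blast
  obtain u' v' p' b' where D': "diamond G u' v' p' b'" "u' < v'" "p' < b'"
    and z: "(x, z) = (p', v') \<or> (x, z) = (v', p') \<or> (x, z) = (u', b') \<or> (x, z) = (b', u')"
    using assms(2) False unfolding skipped_def by blast
  have "{u, v} = {u', v'} \<and> {p, b} = {p', b'}"
    using diamond_unique[OF D(1) D'(1), of x] y z by blast
  \<comment> \<open>The order leaves only one labelling of each pair.\<close>
  then have "u = u'" "v = v'" "p = p'" "b = b'"
    using D(2,3) D'(2,3) by (metis doubleton_eq_iff order_less_asym)+
  then show ?thesis
    using y z diamond_nbs(3)[OF D(1)] by auto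
qed

lemma skipped_exists:
  assumes x: "x \<in> verts G" "card (nb G x) \<noteq> 2"
  shows "card (nb G x) = 3 \<and> (\<exists>y. skipped x y)"
proof -
  have l: "card (nb G x) = 3 \<and> ((\<exists>v. ear G x v) \<or> (\<exists>u v p b. diamond G u v p b \<and> x \<in> {u, v, p, b}))"
    using traversable[OF x(1)] x(2) unfolding locally_traversable_def by blast
  moreover have "\<exists>y. skipped x y" if D: "diamond G u v p b" "x \<in> {u, v, p, b}" for u v p b
  proof -
    have "u \<noteq> v" "p \<noteq> b"
      using diamond_nbs(3)[OF D(1)] by auto
    \<comment> \<open>Swapping \<open>u, v\<close> or \<open>p, b\<close> brings the diamond into
      the order that \<open>skipped\<close> asks for.\<close>
    then consider "u < v" "p < b" | "v < u" "p < b" | "u < v" "b < p" | "v < u" "b < p"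
      by fastforce
    then obtain u' v' p' b' where "diamond G u' v' p' b'" "u' < v'" "p' < b'" "x \<in> {u', v', p', b'}"
      using D diamond_swap[OF D(1)] diamond_swap(2)[OF diamond_swap(1)[OF D(1)]]
      by cases blast+
    then show ?thesis
      unfolding skipped_def by blast
  qed
  ultimately show ?thesis
    unfolding skipped_def by blast
qed

lemma kept_two_regular: "two_regular (verts G) kept"
  unfolding two_regular_def
proof (intro conjI ballI)
  show "symp kept"
    using kept_sym by (blast intro: sympI)
  fix x assume x: "x \<in> verts G"
  show "card {y. kept x y} = 2"
  proof (cases "card (nb G x) = 2")
    case True
    then have "{y. kept x y} = nb G x"
      unfolding kept_def using skipped_nb by fastforce
    with True show ?thesis by simp
  next
    case False
    then obtain y where y: "card (nb G x) = 3" "skipped x y"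
      using skipped_exists[OF x] by blast
    then have "{y. kept x y} = nb G x - {y}" "y \<in> nb G x"
      unfolding kept_def using skipped_unique skipped_nb by blast+
    with y show ?thesis by simp
  qed
qed

text \<open>A kept path joins the ends of every deleted edge, through \<open>p\<close> in an ear and
  along \<open>p, u, v, b\<close> in a diamond. Hence deletion preserves connectivity.\<close>

lemma kept_closed:
  assumes S: "\<And>x y. x \<in> S \<Longrightarrow> kept x y \<Longrightarrow> y \<in> S" and x: "x \<in> S" "y \<in> nb G x"
  shows "y \<in> S"
proof (cases "skipped x y")
  case True
  have diamond: "kept p u" "kept u v" "kept v b" if D: "diamond G u v p b" "u < v" "p < b" for u v p b
  proof -
    have "skipped p v" "skipped v p" "skipped u b"
      unfolding skipped_def using D by blast+
    then have "\<not> skipped p u" "\<not> skipped u v" "\<not> skipped v b"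
      using skipped_unique diamond_nbs(3)[OF D(1)] by fastforce+
    moreover have "u \<in> nb G p" "v \<in> nb G u" "b \<in> nb G v"
      using D nb_sym[of u G p] unfolding diamond_def by blast+
    ultimately show "kept p u" "kept u v" "kept v b"
      unfolding kept_def by blast+
  qed
  consider "ear G x y" | u v p b where "diamond G u v p b" "u < v" "p < b"
    "(x, y) = (p, v) \<or> (x, y) = (v, p) \<or> (x, y) = (u, b) \<or> (x, y) = (b, u)"
    using True unfolding skipped_def by blast
  then show ?thesis
  proof cases
    case 1
    then obtain p where "p \<in> nb G x" "y \<in> nb G p" "card (nb G p) = 2"
      unfolding ear_def using nb_sym by metis
    \<comment> \<open>Skipped edges have both ends of degree 3, so both edges at \<open>p\<close>
      are kept.\<close>
    then have "kept x p" "kept p y"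
      unfolding kept_def using skipped_nb by fastforce+
    then show ?thesis using S x by blast
  next
    case 2
    then show ?thesis
      using diamond[OF 2(1-3)] kept_sym S x by blast
  qed
next
  case False
  then show ?thesis using S x unfolding kept_def by blast
qed

lemma hamilton: "has_hamilton_cycle G"
proof (rule two_regular_connected_hamilton[OF simple _ kept_two_regular])
  show "verts G \<noteq> {}" using large by auto
  show "\<And>x y. kept x y \<Longrightarrow> y \<in> nb G x"
    by (simp add: kept_def)
  fix S assume S: "S \<subseteq> verts G" "S \<noteq> {}" "\<And>x y. x \<in> S \<Longrightarrow> kept x y \<Longrightarrow> y \<in> S"
  have "\<forall>x\<in>S. nb G x \<subseteq> S"
    using kept_closed S(3) by blast
  then show "S = verts G"
    using S(1,2) connected unfolding graph_connected_def by blast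
qed

end

theorem hamilton_cycle_iff_traversable:
  fixes G :: "'a :: linorder ugraph"
  assumes "simple_graph G" "subgraph_free graph_H1 G" "6 \<le> card (verts G)"
  shows "has_hamilton_cycle G \<longleftrightarrow> graph_connected G \<and> (\<forall>x\<in>verts G. locally_traversable G x)"
  using hamilton_cycle_traversable[OF assms] traversable_graph.hamilton[of G] assms
  unfolding traversable_graph_def by blast

section \<open>Deciding first-order properties\<close>

text \<open>Upper bounds instead of exact times let branches of different length share one
  bound.\<close>

definition runs :: "prog \<Rightarrow> config \<Rightarrow> nat \<Rightarrow> config \<Rightarrow> bool" where
  "runs p s T s' \<longleftrightarrow> (\<exists>t\<le>T. exec p s t s')"

lemma runs_mono: "runs p s T s' \<Longrightarrow> T \<le> T' \<Longrightarrow> runs p s T' s'"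
  unfolding runs_def using order_trans by blast

lemma runs_basic:
  "runs (Const i k) (r, m) 1 (r(i := k), m)"
  "runs (Add i j k) (r, m) 1 (r(i := r j + r k), m)"
  "runs (Sub i j k) (r, m) 1 (r(i := r j - r k), m)"
  "runs (Load i j) (r, m) 1 (r(i := m (r j)), m)"
  "runs (Store i j) (r, m) 1 (r, m(r i := r j))"
  unfolding runs_def by (blast intro: exec.intros)+

lemma runs_Seq: "runs p s T s' \<Longrightarrow> runs q s' T' s'' \<Longrightarrow> runs (Seq p q) s (T + T') s''"
  unfolding runs_def by (meson add_mono exec.Seq)

lemma runs_Cond:
  assumes "r i \<noteq> 0 \<Longrightarrow> runs p (r, m) T s'" "r i = 0 \<Longrightarrow> runs q (r, m) T s'"
  shows "runs (Cond i p q) (r, m) (Suc T) s'"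
  using assms unfolding runs_def by (metis Suc_le_mono exec.CondTrue exec.CondFalse)

lemma runs_While_False: "r i = 0 \<Longrightarrow> runs (While i p) (r, m) 1 (r, m)"
  unfolding runs_def by (blast intro: exec.intros)

lemma runs_While_True:
  assumes "r i \<noteq> 0" "runs p (r, m) T s'" "runs (While i p) s' T' s''"
  shows "runs (While i p) (r, m) (Suc (T + T')) s''"
  using assms unfolding runs_def by (meson Suc_le_mono add_mono exec.WhileTrue)

section \<open>First-order formulas with one unary predicate, and their compilation\<close>

datatype fm = Adj nat nat | Mark nat | Same nat nat | Neg fm | And fm fm | Ex nat fm

fun holds :: "'a ugraph \<Rightarrow> 'a set \<Rightarrow> (nat \<Rightarrow> 'a) \<Rightarrow> fm \<Rightarrow> bool" where
  "holds G S e (Adj i j) \<longleftrightarrow> {e i, e j} \<in> edges G"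
| "holds G S e (Mark i) \<longleftrightarrow> e i \<in> S"
| "holds G S e (Same i j) \<longleftrightarrow> e i = e j"
| "holds G S e (Neg f) \<longleftrightarrow> \<not> holds G S e f"
| "holds G S e (And f g) \<longleftrightarrow> holds G S e f \<and> holds G S e g"
| "holds G S e (Ex k f) \<longleftrightarrow> (\<exists>x\<in>verts G. holds G S (e(k := x)) f)"

text \<open>Variables are named by de Bruijn levels.\<close>

fun well_scoped :: "nat \<Rightarrow> fm \<Rightarrow> bool" where
  "well_scoped d (Adj i j) \<longleftrightarrow> i < d \<and> j < d"
| "well_scoped d (Mark i) \<longleftrightarrow> i < d"
| "well_scoped d (Same i j) \<longleftrightarrow> i < d \<and> j < d"
| "well_scoped d (Neg f) \<longleftrightarrow> well_scoped d f"
| "well_scoped d (And f g) \<longleftrightarrow> well_scoped d f \<and> well_scoped d g"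
| "well_scoped d (Ex k f) \<longleftrightarrow> k = d \<and> well_scoped (Suc d) f"

lemma holds_cong:
  "well_scoped d f \<Longrightarrow> (\<And>i. i < d \<Longrightarrow> e i = e' i) \<Longrightarrow> holds G S e f \<longleftrightarrow> holds G S e' f"
proof (induction f arbitrary: d e e')
  case (Ex k f)
  have "holds G S (e(k := x)) f \<longleftrightarrow> holds G S (e'(k := x)) f" for x
    using Ex.prems by (intro Ex.IH[of "Suc d"]) auto
  then show ?case by simp
next
  case (And f g)
  then show ?case by (metis holds.simps(5) well_scoped.simps(5))
next
  case (Neg f)
  then show ?case by (metis holds.simps(4) well_scoped.simps(4))
qed auto

text \<open>Register 0 holds the length \<open>n * n\<close> of the input, register 1 the number \<open>n\<close> of vertices,
  register 2 the constant 1 and register 7 the constant 0; registers 3 to 6 are scratch, and 4 receives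
  truth values. The mark of the vertex number \<open>i\<close> is kept in the memory cell \<open>n * n + i\<close>.\<close>

abbreviation var :: "nat \<Rightarrow> nat" where "var k \<equiv> 10 + 2 * k"
abbreviation found :: "nat \<Rightarrow> nat" where "found k \<equiv> 11 + 2 * k"

text \<open>Register 3 holds the number of rounds left. It is recomputed after every round because
  the body may use it as scratch.\<close>

definition for_each :: "nat \<Rightarrow> prog \<Rightarrow> prog" where
  "for_each k p = Seq (Const (var k) 0) (Seq (Sub 3 1 (var k))
     (While 3 (Seq p (Seq (Add (var k) (var k) 2) (Sub 3 1 (var k))))))"

text \<open>The address \<open>i * n + j\<close> is built by repeated addition, as there is no
  multiplication. Equality is tested by adding both truncated differences. Adding register 7 copies
  a register, and \<open>Const 5 0\<close> fills an empty branch.\<close>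

fun compile :: "fm \<Rightarrow> prog" where
  "compile (Adj i j) = Seq (Add 3 (var i) 7) (Seq (Add 5 (var j) 7)
     (Seq (While 3 (Seq (Add 5 5 1) (Sub 3 3 2))) (Load 4 5)))"
| "compile (Mark i) = Seq (Add 5 0 (var i)) (Load 4 5)"
| "compile (Same i j) = Seq (Sub 4 (var i) (var j)) (Seq (Sub 5 (var j) (var i))
     (Seq (Add 4 4 5) (Cond 4 (Const 4 0) (Const 4 1))))"
| "compile (Neg f) = Seq (compile f) (Cond 4 (Const 4 0) (Const 4 1))"
| "compile (And f g) = Seq (compile f) (Cond 4 (compile g) (Const 4 0))"
| "compile (Ex k f) = Seq (Const (found k) 0)
     (Seq (for_each k (Seq (compile f) (Cond 4 (Const (found k) 1) (Const 5 0)))) (Add 4 (found k) 7))"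

fun cost :: "fm \<Rightarrow> nat \<Rightarrow> nat" where
  "cost (Adj i j) n = 3 * n + 4"
| "cost (Mark i) n = 2"
| "cost (Same i j) n = 5"
| "cost (Neg f) n = cost f n + 2"
| "cost (And f g) n = cost f n + cost g n + 2"
| "cost (Ex k f) n = (cost f n + 5) * n + 5"

text \<open>\<open>Inv i\<close> describes the state after \<open>i\<close> rounds; it must tolerate
  changes to \<open>var k\<close> and register 3, which loop control overwrites. The 3 extra units
  per round pay for the test and these two updates.\<close>

lemma runs_for_each:
  assumes body: "\<And>i r m. i < n \<Longrightarrow> Inv i r m \<Longrightarrow> r (var k) = i \<Longrightarrow> r 1 = n \<Longrightarrow> r 2 = 1 \<Longrightarrow>
      \<exists>r' m'. runs p (r, m) T (r', m') \<and> Inv (Suc i) r' m' \<and> r' (var k) = i \<and> r' 1 = n \<and> r' 2 = 1"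
    and stable: "\<And>i r m x. Inv i r m \<Longrightarrow> Inv i (r(var k := x)) m" "\<And>i r m x. Inv i r m \<Longrightarrow> Inv i (r(3 := x)) m"
    and init: "Inv 0 r m" "r 1 = n" "r 2 = 1"
  shows "\<exists>r' m'. runs (for_each k p) (r, m) ((T + 3) * n + 3) (r', m') \<and> Inv n r' m'"
proof -
  let ?w = "While 3 (Seq p (Seq (Add (var k) (var k) 2) (Sub 3 1 (var k))))"
  have loop: "Inv i r m \<Longrightarrow> i + j = n \<Longrightarrow> r (var k) = i \<Longrightarrow> r 3 = j \<Longrightarrow> r 1 = n \<Longrightarrow> r 2 = 1 \<Longrightarrow>
      \<exists>r' m'. runs ?w (r, m) ((T + 3) * j + 1) (r', m') \<and> Inv n r' m'" for i j r m
  proof (induction j arbitrary: i r m)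
    case 0
    then show ?case
      using runs_While_False[of r 3] by (metis add_0_right add_0 mult_0_right)
  next
    case (Suc j)
    then obtain r1 m1 where 1: "runs p (r, m) T (r1, m1)" "Inv (Suc i) r1 m1"
        "r1 (var k) = i" "r1 1 = n" "r1 2 = 1"
      using body[of i r m] by auto
    let ?r2 = "r1(var k := Suc i)"
    let ?r3 = "?r2(3 := j)"
    have "runs (Add (var k) (var k) 2) (r1, m1) 1 (?r2, m1)"
      using runs_basic(2)[of "var k" "var k" 2 r1 m1] 1 by simp
    moreover have "runs (Sub 3 1 (var k)) (?r2, m1) 1 (?r3, m1)"
    proof -
      have "n - Suc i = j" using Suc.prems(2) by simp
      then show ?thesis
        using runs_basic(3)[of 3 1 "var k" ?r2 m1] 1(4) by simp
    qed
    ultimately have "runs (Seq p (Seq (Add (var k) (var k) 2) (Sub 3 1 (var k)))) (r, m) (T + (1 + 1)) (?r3, m1)"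
      using 1 by (intro runs_Seq)
    moreover obtain r' m' where "runs ?w (?r3, m1) ((T + 3) * j + 1) (r', m')" "Inv n r' m'"
    proof (atomize_elim, rule Suc.IH)
      show "Inv (Suc i) ?r3 m1" using 1(2) stable by blast
    qed (use 1 Suc.prems in auto)
    moreover have "r 3 \<noteq> 0"
      using Suc.prems by simp
    ultimately have "runs ?w (r, m) (Suc (T + (1 + 1) + ((T + 3) * j + 1))) (r', m')"
      by (intro runs_While_True)
    then have "runs ?w (r, m) ((T + 3) * Suc j + 1) (r', m')"
      by (rule runs_mono) simp
    with \<open>Inv n r' m'\<close> show ?case by blast
  qed
  let ?r2 = "r(var k := 0)"
  let ?r3 = "?r2(3 := n)"
  have "runs (Const (var k) 0) (r, m) 1 (?r2, m)"
    by (rule runs_basic)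
  moreover have "runs (Sub 3 1 (var k)) (?r2, m) 1 (?r3, m)"
    using runs_basic(3)[of 3 1 "var k" ?r2 m] init by simp
  moreover obtain r' m' where "runs ?w (?r3, m) ((T + 3) * n + 1) (r', m')" "Inv n r' m'"
  proof (atomize_elim, rule loop)
    show "Inv 0 ?r3 m" using init(1) stable by blast
  qed (use init in auto)
  ultimately have "runs (for_each k p) (r, m) (1 + (1 + ((T + 3) * n + 1))) (r', m')"
    unfolding for_each_def by (intro runs_Seq)
  then have "runs (for_each k p) (r, m) ((T + 3) * n + 3) (r', m')"
    by (rule runs_mono) simp
  with \<open>Inv n r' m'\<close> show ?thesis by blast
qed

definition encodes :: "'a ugraph \<Rightarrow> 'a list \<Rightarrow> 'a set \<Rightarrow> (nat \<Rightarrow> nat) \<Rightarrow> (nat \<Rightarrow> nat) \<Rightarrow> bool" where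
  "encodes G vs S r m \<longleftrightarrow> (let n = length vs in
     r 0 = n * n \<and> r 1 = n \<and> r 2 = 1 \<and> r 7 = 0 \<and>
     (\<forall>i<n. \<forall>j<n. m (i * n + j) \<noteq> 0 \<longleftrightarrow> {vs ! i, vs ! j} \<in> edges G) \<and>
     (\<forall>i<n. m (n * n + i) \<noteq> 0 \<longleftrightarrow> vs ! i \<in> S))"

lemma encodes_cong:
  "encodes G vs S r m \<Longrightarrow> r' 0 = r 0 \<Longrightarrow> r' 1 = r 1 \<Longrightarrow> r' 2 = r 2 \<Longrightarrow> r' 7 = r 7 \<Longrightarrow> encodes G vs S r' m"
  by (simp add: encodes_def Let_def)

lemma runs_Adj:
  assumes "r 2 = 1" "r 7 = 0"
  shows "\<exists>r'. runs (compile (Adj i j)) (r, m) (3 * r (var i) + 4) (r', m) \<and>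
    r' 4 = m (r (var i) * r 1 + r (var j)) \<and> (\<forall>x. x \<notin> {3, 4, 5} \<longrightarrow> r' x = r x)"
proof -
  let ?w = "While 3 (Seq (Add 5 5 1) (Sub 3 3 2))"
  have loop: "r 2 = 1 \<Longrightarrow> r 3 = c \<Longrightarrow> runs ?w (r, m) (3 * c + 1) (r(5 := c * r 1 + r 5, 3 := 0), m)"
    for c and r :: "nat \<Rightarrow> nat"
  proof (induction c arbitrary: r)
    case 0
    then have "r(5 := 0 * r 1 + r 5, 3 := 0) = r" by auto
    then show ?case
      using runs_While_False[of r 3] 0 by simp
  next
    case (Suc c)
    let ?r1 = "r(5 := r 5 + r 1)"
    let ?r2 = "?r1(3 := c)"
    have "runs (Add 5 5 1) (r, m) 1 (?r1, m)"
      by (rule runs_basic)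
    moreover have "runs (Sub 3 3 2) (?r1, m) 1 (?r2, m)"
      using runs_basic(3)[of 3 3 2 ?r1 m] Suc.prems by simp
    ultimately have "runs (Seq (Add 5 5 1) (Sub 3 3 2)) (r, m) (1 + 1) (?r2, m)"
      by (intro runs_Seq)
    moreover have "runs ?w (?r2, m) (3 * c + 1) (?r2(5 := c * ?r2 1 + ?r2 5, 3 := 0), m)"
      using Suc.prems by (intro Suc.IH) simp_all
    ultimately have "runs ?w (r, m) (Suc (1 + 1 + (3 * c + 1))) (?r2(5 := c * ?r2 1 + ?r2 5, 3 := 0), m)"
      using Suc.prems by (intro runs_While_True) simp_all
    moreover have "?r2(5 := c * ?r2 1 + ?r2 5, 3 := 0) = r(5 := Suc c * r 1 + r 5, 3 := 0)"
      by (auto simp: fun_eq_iff)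
    moreover have "Suc (1 + 1 + (3 * c + 1)) = 3 * Suc c + 1"
      by simp
    ultimately show ?case
      by (simp only:)
  qed
  let ?r1 = "r(3 := r (var i))"
  let ?r2 = "?r1(5 := r (var j))"
  let ?r3 = "?r2(5 := r (var i) * ?r2 1 + ?r2 5, 3 := 0)"
  let ?r4 = "?r3(4 := m (?r3 5))"
  have "runs (Add 3 (var i) 7) (r, m) 1 (?r1, m)"
    using runs_basic(2)[of 3 "var i" 7 r m] assms by simp
  moreover have "runs (Add 5 (var j) 7) (?r1, m) 1 (?r2, m)"
    using runs_basic(2)[of 5 "var j" 7 ?r1 m] assms by simp
  moreover have "runs ?w (?r2, m) (3 * r (var i) + 1) (?r3, m)"
    using assms by (intro loop) simp_all
  moreover have "runs (Load 4 5) (?r3, m) 1 (?r4, m)"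
    by (rule runs_basic)
  ultimately have "runs (compile (Adj i j)) (r, m) (1 + (1 + (3 * r (var i) + 1 + 1))) (?r4, m)"
    unfolding compile.simps by (intro runs_Seq)
  then have "runs (compile (Adj i j)) (r, m) (3 * r (var i) + 4) (?r4, m)"
    by (rule runs_mono) simp
  then show ?thesis
    by (intro exI[of _ ?r4]) simp
qed

lemma runs_not: "runs (Cond 4 (Const 4 0) (Const 4 1)) (r, m) 2 (r(4 := if r 4 = 0 then 1 else 0), m)"
proof -
  have "runs (Cond 4 (Const 4 0) (Const 4 1)) (r, m) (Suc 1) (r(4 := if r 4 = 0 then 1 else 0), m)"
    using runs_basic(1)[of 4 _ r m] by (intro runs_Cond) auto
  then show ?thesis by (rule runs_mono) simp
qed

text \<open>The frame condition carries the induction: at depth \<open>d\<close> only scratch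
  registers and registers from \<open>var d\<close> on may change, so counters and flags of
  enclosing quantifiers survive. Memory stays as it is.\<close>

lemma compile_correct:
  assumes "verts G = set vs" "distinct vs"
  shows "well_scoped d f \<Longrightarrow> encodes G vs S r m \<Longrightarrow> \<forall>i<d. r (var i) < length vs \<Longrightarrow>
    \<exists>r'. runs (compile f) (r, m) (cost f (length vs)) (r', m) \<and>
      (r' 4 \<noteq> 0 \<longleftrightarrow> holds G S (\<lambda>i. vs ! r (var i)) f) \<and>
      (\<forall>x. x < var d \<longrightarrow> x \<notin> {3, 4, 5} \<longrightarrow> r' x = r x)"
proof (induction f arbitrary: d r)
  case (Adj i j)
  define n where "n = length vs"
  have e: "r 1 = n" "r 2 = 1" "r 7 = 0" "r (var i) < n" "r (var j) < n"
    using Adj unfolding encodes_def Let_def n_def by auto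
  then have "m (r (var i) * r 1 + r (var j)) \<noteq> 0 \<longleftrightarrow> {vs ! r (var i), vs ! r (var j)} \<in> edges G"
    using Adj(2) unfolding encodes_def Let_def n_def by metis
  moreover obtain r' where r': "runs (compile (Adj i j)) (r, m) (3 * r (var i) + 4) (r', m)"
    "r' 4 = m (r (var i) * r 1 + r (var j))" "\<forall>x. x \<notin> {3, 4, 5} \<longrightarrow> r' x = r x"
    using runs_Adj[OF e(2,3)] by blast
  moreover have "3 * r (var i) + 4 \<le> cost (Adj i j) (length vs)"
    using e unfolding n_def by simp
  ultimately show ?case
    using runs_mono[OF r'(1)] by (intro exI[of _ r']) simp
next
  case (Mark i)
  let ?r1 = "r(5 := r 0 + r (var i))"
  let ?r2 = "?r1(4 := m (?r1 5))"
  have "runs (compile (Mark i)) (r, m) (1 + 1) (?r2, m)"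
    unfolding compile.simps by (rule runs_Seq[OF runs_basic(2) runs_basic(4)])
  then have "runs (compile (Mark i)) (r, m) (cost (Mark i) (length vs)) (?r2, m)"
    by (rule runs_mono) simp
  moreover have "?r2 4 \<noteq> 0 \<longleftrightarrow> vs ! r (var i) \<in> S"
    using Mark unfolding encodes_def Let_def by simp
  ultimately show ?case
    by (intro exI[of _ ?r2] conjI) (assumption, simp_all)
next
  case (Same i j)
  let ?r1 = "r(4 := r (var i) - r (var j))"
  let ?r2 = "?r1(5 := r (var j) - r (var i))"
  let ?r3 = "?r2(4 := ?r2 4 + ?r2 5)"
  let ?r4 = "?r3(4 := if ?r3 4 = 0 then 1 else 0)"
  have "runs (Sub 4 (var i) (var j)) (r, m) 1 (?r1, m)"
    by (rule runs_basic)
  moreover have "runs (Sub 5 (var j) (var i)) (?r1, m) 1 (?r2, m)"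
    using runs_basic(3)[of 5 "var j" "var i" ?r1 m] by simp
  moreover have "runs (Add 4 4 5) (?r2, m) 1 (?r3, m)"
    by (rule runs_basic)
  moreover note runs_not[of ?r3 m]
  ultimately have "runs (compile (Same i j)) (r, m) (1 + (1 + (1 + 2))) (?r4, m)"
    unfolding compile.simps by (intro runs_Seq)
  then have "runs (compile (Same i j)) (r, m) (cost (Same i j) (length vs)) (?r4, m)"
    by (rule runs_mono) simp
  moreover have "?r4 4 \<noteq> 0 \<longleftrightarrow> vs ! r (var i) = vs ! r (var j)"
    using Same assms(2) by (auto simp: nth_eq_iff_index_eq)
  ultimately show ?case
    by (intro exI[of _ ?r4] conjI) (assumption, simp_all)
next
  case (Neg f)
  then obtain r1 where r1: "runs (compile f) (r, m) (cost f (length vs)) (r1, m)"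
      "r1 4 \<noteq> 0 \<longleftrightarrow> holds G S (\<lambda>i. vs ! r (var i)) f" "\<forall>x. x < var d \<longrightarrow> x \<notin> {3, 4, 5} \<longrightarrow> r1 x = r x"
    using Neg.IH[of d r] unfolding well_scoped.simps by blast
  have "runs (compile (Neg f)) (r, m) (cost (Neg f) (length vs)) (r1(4 := if r1 4 = 0 then 1 else 0), m)"
    unfolding compile.simps cost.simps by (rule runs_Seq[OF r1(1) runs_not])
  with r1 show ?case
    by (intro exI[of _ "r1(4 := if r1 4 = 0 then 1 else 0)"] conjI) (assumption, auto)
next
  case (And f g)
  then obtain r1 where r1: "runs (compile f) (r, m) (cost f (length vs)) (r1, m)"
      "r1 4 \<noteq> 0 \<longleftrightarrow> holds G S (\<lambda>i. vs ! r (var i)) f" "\<forall>x. x < var d \<longrightarrow> x \<notin> {3, 4, 5} \<longrightarrow> r1 x = r x"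
    using And.IH(1)[of d r] unfolding well_scoped.simps by blast
  have wg: "well_scoped d g" using And.prems by simp
  have vars: "r1 (var i) = r (var i)" if "i < d" for i
    using r1(3) that by simp
  have "encodes G vs S r1 m"
    using And.prems(2) r1(3) by (elim encodes_cong) simp_all
  moreover have "\<forall>i<d. r1 (var i) < length vs"
    using And.prems(3) vars by simp
  ultimately obtain r2 where r2: "runs (compile g) (r1, m) (cost g (length vs)) (r2, m)"
      "r2 4 \<noteq> 0 \<longleftrightarrow> holds G S (\<lambda>i. vs ! r1 (var i)) g" "\<forall>x. x < var d \<longrightarrow> x \<notin> {3, 4, 5} \<longrightarrow> r2 x = r1 x"
    using And.IH(2)[OF wg, of r1] by blast
  have g: "holds G S (\<lambda>i. vs ! r1 (var i)) g \<longleftrightarrow> holds G S (\<lambda>i. vs ! r (var i)) g"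
    using wg vars by (intro holds_cong) auto
  let ?r3 = "if r1 4 = 0 then r1(4 := 0) else r2"
  have "runs (Cond 4 (compile g) (Const 4 0)) (r1, m) (Suc (cost g (length vs) + 1)) (?r3, m)"
  proof (rule runs_Cond)
    assume "r1 4 \<noteq> 0"
    then show "runs (compile g) (r1, m) (cost g (length vs) + 1) (?r3, m)"
      using r2 runs_mono by fastforce
  next
    assume "r1 4 = 0"
    then show "runs (Const 4 0) (r1, m) (cost g (length vs) + 1) (?r3, m)"
      using runs_mono[OF runs_basic(1)[of 4 0 r1 m]] by simp
  qed
  then have "runs (compile (And f g)) (r, m) (cost f (length vs) + Suc (cost g (length vs) + 1)) (?r3, m)"
    unfolding compile.simps by (rule runs_Seq[OF r1(1)])
  then have "runs (compile (And f g)) (r, m) (cost (And f g) (length vs)) (?r3, m)"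
    by (rule runs_mono) simp
  then show ?case
    using r1 r2 g by (intro exI[of _ ?r3]) auto
next
  case (Ex k f)
  have k: "k = d" and wf: "well_scoped (Suc k) f"
    using Ex.prems(1) by simp_all
  let ?n = "length vs" and ?e = "\<lambda>i. vs ! r (var i)"
  let ?p = "Seq (compile f) (Cond 4 (Const (found k) 1) (Const 5 0))"
  define Inv where "Inv i r' m' \<longleftrightarrow> m' = m \<and> (\<forall>x. x < var k \<longrightarrow> x \<notin> {3, 4, 5} \<longrightarrow> r' x = r x) \<and>
    (r' (found k) \<noteq> 0 \<longleftrightarrow> (\<exists>j<i. holds G S (?e(k := vs ! j)) f))" for i r' m'
  have n: "r 1 = ?n" "r 2 = 1" "r 7 = 0"
    using Ex.prems(2) unfolding encodes_def Let_def by auto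
  have "\<exists>r' m'. runs (for_each k ?p) (r(found k := 0), m) ((cost f ?n + 2 + 3) * ?n + 3) (r', m') \<and> Inv ?n r' m'"
  proof (rule runs_for_each)
    fix i r1 m1 assume i: "i < ?n" "Inv i r1 m1" "r1 (var k) = i" "r1 1 = ?n" "r1 2 = 1"
    have r1: "r1 x = r x" if "x < var k" "x \<notin> {3, 4, 5}" for x
      using i that unfolding Inv_def by blast
    have m1: "m1 = m" using i unfolding Inv_def by blast
    have "encodes G vs S r1 m"
      using r1 by (intro encodes_cong[OF Ex.prems(2)]) simp_all
    moreover have "\<forall>j<Suc k. r1 (var j) < ?n"
      using Ex.prems(3) r1 i k by (auto simp: less_Suc_eq)
    ultimately obtain r2 where r2: "runs (compile f) (r1, m) (cost f ?n) (r2, m)"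
        "r2 4 \<noteq> 0 \<longleftrightarrow> holds G S (\<lambda>i. vs ! r1 (var i)) f"
        "\<forall>x. x < var (Suc k) \<longrightarrow> x \<notin> {3, 4, 5} \<longrightarrow> r2 x = r1 x"
      using Ex.IH[OF wf] by blast
    have f: "holds G S (\<lambda>i. vs ! r1 (var i)) f \<longleftrightarrow> holds G S (?e(k := vs ! i)) f"
      using wf r1 i(3) by (intro holds_cong) (auto simp: less_Suc_eq)
    let ?r3 = "if r2 4 = 0 then r2(5 := 0) else r2(found k := 1)"
    have "runs (Cond 4 (Const (found k) 1) (Const 5 0)) (r2, m) (Suc 1) (?r3, m)"
      using runs_basic(1)[of _ _ r2 m] by (intro runs_Cond) auto
    then have "runs ?p (r1, m) (cost f ?n + Suc 1) (?r3, m)"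
      by (rule runs_Seq[OF r2(1)])
    then have "runs ?p (r1, m1) (cost f ?n + 2) (?r3, m)"
      unfolding m1 by (rule runs_mono) simp
    moreover have "Inv (Suc i) ?r3 m"
      using r2 f i(2) r1 unfolding Inv_def by (auto simp: less_Suc_eq)
    moreover have "?r3 (var k) = i" "?r3 1 = ?n" "?r3 2 = 1"
      using r2(3) i by auto
    ultimately show "\<exists>r' m'. runs ?p (r1, m1) (cost f ?n + 2) (r', m') \<and> Inv (Suc i) r' m' \<and>
        r' (var k) = i \<and> r' 1 = ?n \<and> r' 2 = 1"
      by blast
  qed (use n in \<open>auto simp: Inv_def\<close>)
  then obtain r1 m1 where r1: "runs (for_each k ?p) (r(found k := 0), m) ((cost f ?n + 2 + 3) * ?n + 3) (r1, m1)"
    "Inv ?n r1 m1"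
    by blast
  have m1: "m1 = m" using r1(2) unfolding Inv_def by blast
  note r1 = r1[unfolded m1]
  let ?r2 = "r1(4 := r1 (found k))"
  have "r1 7 = 0"
    using r1(2) n unfolding Inv_def by simp
  then have "runs (Add 4 (found k) 7) (r1, m) 1 (?r2, m)"
    using runs_basic(2)[of 4 "found k" 7 r1 m] by simp
  then have "runs (compile (Ex k f)) (r, m) (1 + ((cost f ?n + 2 + 3) * ?n + 3 + 1)) (?r2, m)"
    unfolding compile.simps by (intro runs_Seq[OF runs_basic(1)] runs_Seq[OF r1(1)])
  then have "runs (compile (Ex k f)) (r, m) (cost (Ex k f) ?n) (?r2, m)"
    by (rule runs_mono) simp
  moreover have "?r2 4 \<noteq> 0 \<longleftrightarrow> holds G S ?e (Ex k f)"
  proof -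
    have "(\<exists>j<?n. holds G S (?e(k := vs ! j)) f) \<longleftrightarrow> (\<exists>x\<in>verts G. holds G S (?e(k := x)) f)"
      unfolding assms(1) by (metis in_set_conv_nth)
    then show ?thesis
      using r1(2) unfolding Inv_def by simp
  qed
  moreover have "\<forall>x. x < var d \<longrightarrow> x \<notin> {3, 4, 5} \<longrightarrow> ?r2 x = r x"
    using r1(2) unfolding Inv_def k by simp
  ultimately show ?case by blast
qed

section \<open>Deciding connectivity\<close>

definition setup_prog :: prog where
  "setup_prog = Seq (Const 2 1) (Seq (Add 3 0 7) (While 3 (Seq (Add 6 6 1) (Seq (Add 6 6 1)
     (Seq (Add 6 6 2) (Seq (Add 1 1 2) (Sub 3 0 6)))))))"

text \<open>The square root of the input length is found by adding up odd numbers.\<close>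

lemma runs_setup_prog:
  assumes "r 0 = n * n" "r 1 = 0" "r 6 = 0" "r 7 = 0"
  shows "\<exists>r'. runs setup_prog (r, m) (6 * n + 3) (r', m) \<and> r' 0 = n * n \<and> r' 1 = n \<and> r' 2 = 1 \<and> r' 7 = 0"
proof -
  let ?p = "Seq (Add 6 6 1) (Seq (Add 6 6 1) (Seq (Add 6 6 2) (Seq (Add 1 1 2) (Sub 3 0 6))))"
  have loop: "k + j = n \<Longrightarrow> r 0 = n * n \<Longrightarrow> r 1 = k \<Longrightarrow> r 2 = 1 \<Longrightarrow> r 3 = n * n - k * k \<Longrightarrow> r 6 = k * k \<Longrightarrow> r 7 = 0 \<Longrightarrow>
      \<exists>r'. runs (While 3 ?p) (r, m) (6 * j + 1) (r', m) \<and> r' 0 = n * n \<and> r' 1 = n \<and> r' 2 = 1 \<and> r' 7 = 0"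
    for j k and r :: "nat \<Rightarrow> nat"
  proof (induction j arbitrary: k r)
    case 0
    then have "runs (While 3 ?p) (r, m) 1 (r, m)"
      by (intro runs_While_False) simp
    with 0 show ?case by auto
  next
    case (Suc j)
    let ?r1 = "r(6 := r 6 + r 1)"
    let ?r2 = "?r1(6 := ?r1 6 + ?r1 1)"
    let ?r3 = "?r2(6 := ?r2 6 + ?r2 2)"
    let ?r4 = "?r3(1 := ?r3 1 + ?r3 2)"
    let ?r5 = "?r4(3 := ?r4 0 - ?r4 6)"
    have "runs ?p (r, m) (1 + (1 + (1 + (1 + 1)))) (?r5, m)"
      by (rule runs_Seq[OF runs_basic(2) runs_Seq[OF runs_basic(2) runs_Seq[OF runs_basic(2)
            runs_Seq[OF runs_basic(2) runs_basic(3)]]]])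
    moreover have "\<exists>r'. runs (While 3 ?p) (?r5, m) (6 * j + 1) (r', m) \<and> r' 0 = n * n \<and> r' 1 = n \<and> r' 2 = 1 \<and> r' 7 = 0"
      by (rule Suc.IH[of "Suc k"]) (use Suc.prems in auto)
    then obtain r' where r': "runs (While 3 ?p) (?r5, m) (6 * j + 1) (r', m)"
      "r' 0 = n * n" "r' 1 = n" "r' 2 = 1" "r' 7 = 0"
      by blast
    moreover have "r 3 \<noteq> 0"
    proof -
      \<comment> \<open>The inequality is strict before the last round, so the truncated difference
        in register 3 stays positive until \<open>k = n\<close>.\<close>
      have "k * k < n * n"
        using Suc.prems(1) by (intro mult_strict_mono') auto
      then show ?thesis using Suc.prems by simp
    qed
    ultimately have "runs (While 3 ?p) (r, m) (Suc (1 + (1 + (1 + (1 + 1))) + (6 * j + 1))) (r', m)"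
      by (intro runs_While_True)
    then have "runs (While 3 ?p) (r, m) (6 * Suc j + 1) (r', m)"
      by (rule runs_mono) simp
    with r' show ?case by blast
  qed
  let ?r1 = "r(2 := 1)"
  let ?r2 = "?r1(3 := ?r1 0 + ?r1 7)"
  have "\<exists>r'. runs (While 3 ?p) (?r2, m) (6 * n + 1) (r', m) \<and> r' 0 = n * n \<and> r' 1 = n \<and> r' 2 = 1 \<and> r' 7 = 0"
    by (rule loop[of 0]) (use assms in auto)
  then obtain r' where r': "runs (While 3 ?p) (?r2, m) (6 * n + 1) (r', m)"
    "r' 0 = n * n" "r' 1 = n" "r' 2 = 1" "r' 7 = 0"
    by blast
  then have "runs setup_prog (r, m) (1 + (1 + (6 * n + 1))) (r', m)"
    unfolding setup_prog_def by (intro runs_Seq[OF runs_basic(1)] runs_Seq[OF runs_basic(2)])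
  then have "runs setup_prog (r, m) (6 * n + 3) (r', m)"
    by (rule runs_mono) simp
  with r' show ?thesis by blast
qed

definition spread :: "'a ugraph \<Rightarrow> 'a \<Rightarrow> 'a set \<Rightarrow> 'a set" where
  "spread G v S = (if \<exists>u\<in>verts G. u \<in> S \<and> {u, v} \<in> edges G then insert v S else S)"

text \<open>As many passes as vertices suffice, since every pass before closure marks a new
  vertex.\<close>

definition reached :: "'a ugraph \<Rightarrow> 'a list \<Rightarrow> 'a set" where
  "reached G vs = (fold (spread G) vs ^^ length vs) {vs ! 0}"

text \<open>Level 1 is the vertex to be marked. Level 0 is taken by the counter of passes, so the
  witness is at level 2.\<close>

definition spread_fm :: fm where
  "spread_fm = Ex 2 (And (Mark 2) (Adj 2 1))"

definition spread_prog :: prog where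
  "spread_prog = Seq (compile spread_fm) (Cond 4 (Seq (Add 5 0 (var 1)) (Store 5 2)) (Const 5 0))"

lemma matrix_index_less:
  fixes a b n :: nat
  assumes "a < n" "b < n"
  shows "a * n + b < n * n"
proof -
  have "a * n + b < Suc a * n" using assms by simp
  also have "\<dots> \<le> n * n" using assms by (intro mult_le_mono1) simp
  finally show ?thesis .
qed

lemma encodes_mark:
  assumes e: "encodes G vs S r m" and i: "i < length vs" and vs: "distinct vs"
  shows "encodes G vs (insert (vs ! i) S) r (m(r 0 + i := 1))"
proof -
  define n where "n = length vs"
  have "r 0 = n * n"
    using e unfolding encodes_def Let_def n_def by blast
  \<comment> \<open>Marks lie beyond the matrix, so setting one leaves the adjacency entries
    intact.\<close>
  moreover have "a * n + b \<noteq> n * n + i" if "a < n" "b < n" for a b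
    using matrix_index_less[OF that] by simp
  moreover have "vs ! j = vs ! i \<longleftrightarrow> j = i" if "j < n" for j
    using that i vs by (simp add: n_def nth_eq_iff_index_eq)
  ultimately show ?thesis
    using e unfolding encodes_def Let_def n_def[symmetric] by simp
qed

lemma runs_spread_prog:
  assumes G: "verts G = set vs" "distinct vs" and e: "encodes G vs S r m"
    and i: "r (var 0) < length vs" "r (var 1) < length vs"
  shows "\<exists>r' m'. runs spread_prog (r, m) (cost spread_fm (length vs) + 3) (r', m') \<and>
    encodes G vs (spread G (vs ! r (var 1)) S) r' m' \<and> r' (var 0) = r (var 0) \<and> r' (var 1) = r (var 1)"
proof -
  \<comment> \<open>The depth is 2, so the pass counter in \<open>var 0\<close> also has to be a
    valid vertex index.\<close>
  have "\<exists>r'. runs (compile spread_fm) (r, m) (cost spread_fm (length vs)) (r', m) \<and>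
      (r' 4 \<noteq> 0 \<longleftrightarrow> holds G S (\<lambda>i. vs ! r (var i)) spread_fm) \<and>
      (\<forall>x. x < var 2 \<longrightarrow> x \<notin> {3, 4, 5} \<longrightarrow> r' x = r x)"
    using i by (intro compile_correct[OF G _ e]) (auto simp: spread_fm_def less_2_cases_iff)
  then obtain r1 where r1: "runs (compile spread_fm) (r, m) (cost spread_fm (length vs)) (r1, m)"
      "r1 4 \<noteq> 0 \<longleftrightarrow> holds G S (\<lambda>i. vs ! r (var i)) spread_fm"
      "\<forall>x. x < var 2 \<longrightarrow> x \<notin> {3, 4, 5} \<longrightarrow> r1 x = r x"
    by blast
  have holds: "r1 4 \<noteq> 0 \<longleftrightarrow> (\<exists>u\<in>verts G. u \<in> S \<and> {u, vs ! r (var 1)} \<in> edges G)"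
    unfolding r1(2) spread_fm_def by simp
  have e1: "encodes G vs S r1 m"
    using r1(3) by (intro encodes_cong[OF e]) simp_all
  have vars: "r1 (var 0) = r (var 0)" "r1 (var 1) = r (var 1)"
    using r1(3) by simp_all
  let ?r2 = "r1(5 := r1 0 + r1 (var 1))"
  let ?s = "if r1 4 = 0 then (r1(5 := 0), m) else (?r2, m(?r2 5 := ?r2 2))"
  have "runs (Cond 4 (Seq (Add 5 0 (var 1)) (Store 5 2)) (Const 5 0)) (r1, m) (Suc 2) ?s"
  proof (rule runs_Cond)
    assume "r1 4 \<noteq> 0"
    then show "runs (Seq (Add 5 0 (var 1)) (Store 5 2)) (r1, m) 2 ?s"
    proof -
      have "runs (Seq (Add 5 0 (var 1)) (Store 5 2)) (r1, m) (1 + 1) (?r2, m(?r2 5 := ?r2 2))"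
        by (rule runs_Seq[OF runs_basic(2) runs_basic(5)])
      then show ?thesis
        using \<open>r1 4 \<noteq> 0\<close> by (simp only: if_False one_add_one)
    qed
  next
    assume "r1 4 = 0"
    then show "runs (Const 5 0) (r1, m) 2 ?s"
      using runs_mono[OF runs_basic(1)[of 5 0 r1 m], of 2] by simp
  qed
  then have "runs spread_prog (r, m) (cost spread_fm (length vs) + Suc 2) ?s"
    unfolding spread_prog_def by (rule runs_Seq[OF r1(1)])
  moreover have "encodes G vs (spread G (vs ! r (var 1)) S) (fst ?s) (snd ?s)"
  proof (cases "r1 4 = 0")
    case True
    then have "spread G (vs ! r (var 1)) S = S"
      using holds unfolding spread_def by auto
    moreover have "encodes G vs S (r1(5 := 0)) m"
      by (rule encodes_cong[OF e1]) simp_all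
    ultimately show ?thesis using True by simp
  next
    case False
    then have "spread G (vs ! r (var 1)) S = insert (vs ! r (var 1)) S"
      using holds unfolding spread_def by auto
    moreover have "encodes G vs (insert (vs ! r (var 1)) S) r1 (m(r1 0 + r (var 1) := 1))"
      by (rule encodes_mark[OF e1 i(2) G(2)])
    then have "encodes G vs (insert (vs ! r (var 1)) S) ?r2 (m(r1 0 + r (var 1) := 1))"
      by (rule encodes_cong) simp_all
    moreover have "r1 2 = 1"
      using e1 unfolding encodes_def Let_def by blast
    ultimately show ?thesis using False vars by simp
  qed
  moreover have "fst ?s (var 0) = r (var 0)" "fst ?s (var 1) = r (var 1)"
    using vars by simp_all
  ultimately show ?thesis
    by (intro exI[of _ "fst ?s"] exI[of _ "snd ?s"]) simp
qed

definition round_cost :: "nat \<Rightarrow> nat" where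
  "round_cost n = (cost spread_fm n + 6) * n + 3"

lemma runs_mark_prog:
  assumes G: "verts G = set vs" "distinct vs" and e: "encodes G vs {vs ! 0} r m"
  shows "\<exists>r' m'. runs (for_each 0 (for_each 1 spread_prog)) (r, m)
      ((round_cost (length vs) + 3) * length vs + 3) (r', m') \<and> encodes G vs (reached G vs) r' m'"
proof -
  let ?n = "length vs"
  define Inv where "Inv k r m \<longleftrightarrow> encodes G vs ((fold (spread G) vs ^^ k) {vs ! 0}) r m"
    for k and r m :: "nat \<Rightarrow> nat"
  have regs: "r 1 = ?n" "r 2 = 1" if "encodes G vs S r m" for S r m
    using that unfolding encodes_def Let_def by blast+
  have "\<exists>r' m'. runs (for_each 0 (for_each 1 spread_prog)) (r, m)
      ((round_cost ?n + 3) * ?n + 3) (r', m') \<and> Inv ?n r' m'"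
  proof (rule runs_for_each)
    fix k r m assume k: "k < ?n" "Inv k r m" "r (var 0) = k"
    let ?S = "(fold (spread G) vs ^^ k) {vs ! 0}"
    \<comment> \<open>Besides the marks, the inner loop must preserve the pass counter, on which the
      outer loop relies.\<close>
    define J where "J i r m \<longleftrightarrow> encodes G vs (fold (spread G) (take i vs) ?S) r m \<and> r (var 0) = k"
      for i and r m :: "nat \<Rightarrow> nat"
    have "\<exists>r' m'. runs (for_each 1 spread_prog) (r, m) ((cost spread_fm ?n + 3 + 3) * ?n + 3) (r', m') \<and> J ?n r' m'"
    proof (rule runs_for_each)
      fix i r m assume i: "i < ?n" "J i r m" "r (var 1) = i"
      then obtain r' m' where r': "runs spread_prog (r, m) (cost spread_fm ?n + 3) (r', m')"
          "encodes G vs (spread G (vs ! i) (fold (spread G) (take i vs) ?S)) r' m'"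
          "r' (var 0) = k" "r' (var 1) = i"
        using runs_spread_prog[OF G, of "fold (spread G) (take i vs) ?S" r m] k(1) unfolding J_def by auto
      moreover have "J (Suc i) r' m'"
        using r' i(1) unfolding J_def by (simp add: take_Suc_conv_app_nth)
      ultimately show "\<exists>r' m'. runs spread_prog (r, m) (cost spread_fm ?n + 3) (r', m') \<and> J (Suc i) r' m' \<and>
          r' (var 1) = i \<and> r' 1 = ?n \<and> r' 2 = 1"
        using regs by blast
    next
      show "J 0 r m" using k unfolding J_def Inv_def by simp
      show "r 1 = ?n" "r 2 = 1" using k regs unfolding Inv_def by blast+
    qed (auto simp: J_def elim!: encodes_cong)
    then obtain r' m' where r': "runs (for_each 1 spread_prog) (r, m) (round_cost ?n) (r', m')" "J ?n r' m'"
      unfolding round_cost_def by (auto simp: add.assoc)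
    then have "Inv (Suc k) r' m'" "r' (var 0) = k"
      unfolding J_def Inv_def by simp_all
    moreover from this have "r' 1 = ?n" "r' 2 = 1"
      using regs unfolding Inv_def by blast+
    ultimately show "\<exists>r' m'. runs (for_each 1 spread_prog) (r, m) (round_cost ?n) (r', m') \<and> Inv (Suc k) r' m' \<and>
        r' (var 0) = k \<and> r' 1 = ?n \<and> r' 2 = 1"
      using r'(1) by blast
  next
    show "Inv 0 r m" using e unfolding Inv_def by simp
    show "r 1 = ?n" "r 2 = 1" using e regs by blast+
  qed (auto simp: Inv_def elim!: encodes_cong)
  then show ?thesis
    unfolding Inv_def reached_def .
qed

text \<open>\<open>Store 0 2\<close> writes 1 into cell \<open>n * n\<close>, the mark of the first
  vertex. For the empty graph, \<open>encodes\<close> puts no constraint on that cell.\<close>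

definition decide_prog :: "fm \<Rightarrow> prog" where
  "decide_prog f = Seq setup_prog (Seq (Store 0 2) (Seq (for_each 0 (for_each 1 spread_prog))
     (Seq (compile f) (Cond 4 (Const 0 1) (Const 0 0)))))"

definition decide_cost :: "fm \<Rightarrow> nat \<Rightarrow> nat" where
  "decide_cost f n = 6 * n + 3 + (1 + ((round_cost n + 3) * n + 3 + (cost f n + 2)))"

lemma adjacency_word_nth:
  assumes "i < length vs" "j < length vs"
  shows "adjacency_word vs G ! (i * length vs + j) = ({vs ! i, vs ! j} \<in> edges G)"
proof -
  have "i < length us \<Longrightarrow> concat (map (\<lambda>u. map (\<lambda>v. {u, v} \<in> edges G) vs) us) ! (i * length vs + j)
      = ({us ! i, vs ! j} \<in> edges G)" for us
  proof (induction us arbitrary: i)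
    case (Cons u us)
    then show ?case
      using assms(2) by (cases i) (auto simp: nth_append)
  qed simp
  with assms(1) show ?thesis
    unfolding adjacency_word_def by blast
qed

lemma length_adjacency_word: "length (adjacency_word vs G) = length vs * length vs"
  unfolding adjacency_word_def by (simp add: length_concat comp_def sum_list_triv)

lemma runs_decide_prog:
  assumes G: "verts G = set vs" "distinct vs" and f: "well_scoped 0 f"
  shows "\<exists>r m. runs (decide_prog f) (initial_config (adjacency_word vs G)) (decide_cost f (length vs)) (r, m) \<and>
    r 0 = (if holds G (reached G vs) e f then 1 else 0)"
proof -
  let ?n = "length vs" and ?w = "adjacency_word vs G"
  obtain r m where c: "initial_config ?w = (r, m)" by force
  have m: "m = (\<lambda>a. if a < ?n * ?n \<and> ?w ! a then 1 else 0)" and r: "r = (\<lambda>_. 0)(0 := ?n * ?n)"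
    using c unfolding initial_config_def length_adjacency_word by auto
  obtain r1 where r1: "runs setup_prog (r, m) (6 * ?n + 3) (r1, m)"
      "r1 0 = ?n * ?n" "r1 1 = ?n" "r1 2 = 1" "r1 7 = 0"
    using runs_setup_prog[of r ?n m] r by auto
  \<comment> \<open>Cells beyond the input are initially 0, so no vertex is marked.\<close>
  have "encodes G vs {} r1 m"
    using r1 matrix_index_less adjacency_word_nth[of _ vs _ G] unfolding encodes_def Let_def m by simp
  then have e1: "encodes G vs {vs ! 0} r1 (m(r1 0 := r1 2))"
  proof (cases "vs = []")
    case False
    then show ?thesis
      using encodes_mark[OF \<open>encodes G vs {} r1 m\<close>, of 0] G(2) r1(4) by simp
  qed (simp add: encodes_def)
  have s2: "runs (Store 0 2) (r1, m) 1 (r1, m(r1 0 := r1 2))"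
    by (rule runs_basic)
  obtain r2 m2 where r2: "runs (for_each 0 (for_each 1 spread_prog)) (r1, m(r1 0 := r1 2))
      ((round_cost ?n + 3) * ?n + 3) (r2, m2)" "encodes G vs (reached G vs) r2 m2"
    using runs_mark_prog[OF G e1] by blast
  obtain r3 where r3: "runs (compile f) (r2, m2) (cost f ?n) (r3, m2)"
      "r3 4 \<noteq> 0 \<longleftrightarrow> holds G (reached G vs) (\<lambda>i. vs ! r2 (var i)) f"
    using compile_correct[OF G f r2(2)] by auto
  \<comment> \<open>\<open>f\<close> is closed, so the environment left in the registers may be
    replaced by \<open>e\<close>.\<close>
  have "holds G (reached G vs) (\<lambda>i. vs ! r2 (var i)) f \<longleftrightarrow> holds G (reached G vs) e f"
    using f by (rule holds_cong) simp
  with r3(2) have r4: "r3 4 \<noteq> 0 \<longleftrightarrow> holds G (reached G vs) e f" by simp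
  let ?r4 = "r3(0 := if r3 4 = 0 then 0 else 1)"
  have "runs (Cond 4 (Const 0 1) (Const 0 0)) (r3, m2) (Suc 1) (?r4, m2)"
    using runs_basic(1)[of 0 _ r3 m2] by (intro runs_Cond) auto
  then have "runs (Cond 4 (Const 0 1) (Const 0 0)) (r3, m2) 2 (?r4, m2)"
    by (rule runs_mono) simp
  then have "runs (decide_prog f) (r, m) (decide_cost f ?n) (?r4, m2)"
    unfolding decide_prog_def decide_cost_def
    by (intro runs_Seq[OF r1(1)] runs_Seq[OF s2] runs_Seq[OF r2(1)] runs_Seq[OF r3(1)])
  then show ?thesis
    unfolding c using r4 by (intro exI conjI) (assumption, auto)
qed

section \<open>Polynomial bounds in terms of the input length\<close>

definition poly_bounded :: "(nat \<Rightarrow> nat) \<Rightarrow> bool" where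
  "poly_bounded g \<longleftrightarrow> (\<exists>b. \<forall>n. g n \<le> poly b (n * n))"

lemma poly_bounded_const: "poly_bounded (\<lambda>_. c)"
  unfolding poly_bounded_def by (rule exI[of _ "[:c:]"]) simp

text \<open>The input has length \<open>n * n\<close>, which is at least \<open>n\<close>; the
  polynomial is the identity.\<close>

lemma poly_bounded_ident: "poly_bounded (\<lambda>n. n)"
  unfolding poly_bounded_def by (rule exI[of _ "[:0, 1:]"]) simp

lemma poly_bounded_add: "poly_bounded g \<Longrightarrow> poly_bounded h \<Longrightarrow> poly_bounded (\<lambda>n. g n + h n)"
  unfolding poly_bounded_def by (metis add_mono poly_add)

lemma poly_bounded_mult: "poly_bounded g \<Longrightarrow> poly_bounded h \<Longrightarrow> poly_bounded (\<lambda>n. g n * h n)"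
  unfolding poly_bounded_def by (metis mult_le_mono poly_mult)

lemmas poly_bounded_intros =
  poly_bounded_const poly_bounded_ident poly_bounded_add poly_bounded_mult

lemma poly_bounded_cost: "poly_bounded (cost f)"
proof -
  have "poly_bounded (\<lambda>n. cost f n)"
    by (induction f) (simp_all del: add_2_eq_Suc add_2_eq_Suc' add: poly_bounded_intros)
  then show ?thesis by simp
qed

lemma poly_bounded_decide_cost: "poly_bounded (decide_cost f)"
proof -
  have "poly_bounded (\<lambda>n. decide_cost f n)"
    unfolding decide_cost_def round_cost_def
    by (intro poly_bounded_intros poly_bounded_cost)
  then show ?thesis by simp
qed

text \<open>The marked set is the least closed set containing the first vertex: it stays inside
  every such set, and counting shows that the passes suffice to close it.\<close>

lemma graph_connected_iff_reached:
  assumes G: "simple_graph G" and vs: "verts G = set vs" "distinct vs" "vs \<noteq> []"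
  shows "graph_connected G \<longleftrightarrow> verts G \<subseteq> reached G vs"
proof -
  let ?V = "verts G" and ?step = "fold (spread G) vs"
  define closed where "closed S \<longleftrightarrow> (\<forall>x\<in>S. nb G x \<subseteq> S)" for S
  define R where "R k = (?step ^^ k) {vs ! 0}" for k
  have spread_sup: "S \<subseteq> fold (spread G) us S" for S us
  proof (induction us arbitrary: S)
    case (Cons u us)
    have "S \<subseteq> spread G u S" unfolding spread_def by auto
    with Cons show ?case by fastforce
  qed simp
  have spread_sub: "fold (spread G) us S \<subseteq> T" if "S \<subseteq> T" "closed T" for S T us
    using that(1)
  proof (induction us arbitrary: S)
    case (Cons u us)
    then have "spread G u S \<subseteq> T"
      using that(2) unfolding spread_def closed_def nb_def by auto
    with Cons show ?case by simp
  qed simp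
  have closedV: "closed ?V"
    using nb_subset[OF G] unfolding closed_def by blast
  have R0: "vs ! 0 \<in> ?V"
    using vs by simp
  have R_sub: "R k \<subseteq> T" if "vs ! 0 \<in> T" "closed T" for k T
    unfolding R_def using that by (induction k) (simp_all add: spread_sub)
  have RV: "R k \<subseteq> ?V" for k
    using R_sub[OF R0 closedV] .
  have start: "vs ! 0 \<in> R k" for k
    unfolding R_def
  proof (induction k)
    case (Suc k)
    then show ?case using spread_sup by fastforce
  qed simp
  have finV: "finite ?V" using vs by simp
  \<comment> \<open>After as many passes as there are vertices, only the first alternative
    remains.\<close>
  have grow: "closed (R k) \<or> k < card (R k)" for k
  proof (induction k)
    case 0
    then show ?case by (simp add: R_def)
  next
    case (Suc k)
    have step: "R (Suc k) = ?step (R k)" by (simp add: R_def)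
    show ?case
    proof (cases "closed (R k)")
      case True
      then have "R (Suc k) = R k"
        using spread_sub[of "R k" "R k" vs] spread_sup[of "R k" vs] step by blast
      with True show ?thesis by simp
    next
      case False
      then obtain x y where xy: "x \<in> R k" "y \<in> nb G x" "y \<notin> R k"
        unfolding closed_def by blast
      then have "y \<in> set vs" using nb_subset[OF G] vs by blast
      then obtain us ws where "vs = us @ y # ws" by (meson split_list)
      \<comment> \<open>Marks are never removed, so \<open>x\<close> is still marked when the pass
        comes to \<open>y\<close>.\<close>
      moreover have "y \<in> spread G y (fold (spread G) us (R k))"
        using xy spread_sup[of "R k" us] RV unfolding spread_def nb_def by auto
      ultimately have "y \<in> R (Suc k)"
        using spread_sup[of "spread G y (fold (spread G) us (R k))" ws] step by auto
      then have "R k \<subset> R (Suc k)"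
        using spread_sup[of "R k" vs] step xy by auto
      then have "card (R k) < card (R (Suc k))"
        using RV finV by (meson psubset_card_mono finite_subset)
      with Suc False show ?thesis by simp
    qed
  qed
  have "card (R (length vs)) \<le> length vs"
    using card_mono[OF finV RV] vs by (simp add: distinct_card)
  then have closedR: "closed (reached G vs)"
    using grow[of "length vs"] unfolding reached_def R_def by auto
  show ?thesis
  proof
    assume "graph_connected G"
    then show "?V \<subseteq> reached G vs"
      using closedR RV[of "length vs"] start[of "length vs"]
      unfolding graph_connected_def closed_def reached_def R_def by blast
  next
    assume all: "?V \<subseteq> reached G vs"
    show "graph_connected G"
      unfolding graph_connected_def
    proof (intro allI impI)
      fix S assume S: "S \<subseteq> ?V" "S \<noteq> {}" "\<forall>x\<in>S. nb G x \<subseteq> S"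
      have "vs ! 0 \<in> S"
      proof (rule ccontr)
        assume "vs ! 0 \<notin> S"
        \<comment> \<open>By symmetry of adjacency, the complement of a closed set is closed; it
          would then contain all marked vertices.\<close>
        moreover have "closed (?V - S)"
          using S(3) nb_sym[of _ G] nb_subset[OF G] unfolding closed_def by blast
        ultimately have "?V \<subseteq> ?V - S"
          using R_sub[of "?V - S" "length vs"] R0 all unfolding reached_def R_def by blast
        with S show False by blast
      qed
      then show "S = ?V"
        using R_sub[of S "length vs"] S all unfolding reached_def R_def closed_def by blast
    qed
  qed
qed

section \<open>The first-order formula for Hamiltonicity\<close>

abbreviation (input) Or :: "fm \<Rightarrow> fm \<Rightarrow> fm" where "Or f g \<equiv> Neg (And (Neg f) (Neg g))"
abbreviation (input) All :: "nat \<Rightarrow> fm \<Rightarrow> fm" where "All k f \<equiv> Neg (Ex k (Neg f))"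

fun Exs :: "nat \<Rightarrow> nat \<Rightarrow> fm \<Rightarrow> fm" where
  "Exs k 0 f = f"
| "Exs k (Suc m) f = Ex k (Exs (Suc k) m f)"

text \<open>The empty conjunction is a true atom that mentions level 0, whence the condition
  \<open>0 < d\<close> in \<open>well_scoped_Conj\<close>.\<close>

fun Conj :: "fm list \<Rightarrow> fm" where
  "Conj [] = Same 0 0"
| "Conj (f # fs) = And f (Conj fs)"

lemma well_scoped_Exs: "well_scoped k (Exs k m f) \<longleftrightarrow> well_scoped (k + m) f"
  by (induction m arbitrary: k) auto

lemma holds_Exs:
  "holds G S e (Exs k m f) \<longleftrightarrow> (\<exists>xs. length xs = m \<and> set xs \<subseteq> verts G \<and>
     holds G S (\<lambda>i. if k \<le> i \<and> i < k + m then xs ! (i - k) else e i) f)"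
proof (induction m arbitrary: k e)
  case 0
  have "(\<lambda>i. if k \<le> i \<and> i < k + 0 then [] ! (i - k) else e i) = e"
    by (rule ext) auto
  then show ?case by simp
next
  case (Suc m)
  have e: "(\<lambda>i. if Suc k \<le> i \<and> i < Suc k + m then xs ! (i - Suc k) else (e(k := x)) i) =
      (\<lambda>i. if k \<le> i \<and> i < k + Suc m then (x # xs) ! (i - k) else e i)" for x xs
    by (auto simp: fun_eq_iff nth_Cons' Suc_diff_le)
  have "holds G S e (Exs k (Suc m) f) \<longleftrightarrow> (\<exists>x\<in>verts G. \<exists>xs. length xs = m \<and> set xs \<subseteq> verts G \<and>
      holds G S (\<lambda>i. if k \<le> i \<and> i < k + Suc m then (x # xs) ! (i - k) else e i) f)"
    by (simp only: Exs.simps holds.simps Suc.IH e)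
  also have "\<dots> \<longleftrightarrow> (\<exists>ys. length ys = Suc m \<and> set ys \<subseteq> verts G \<and>
      holds G S (\<lambda>i. if k \<le> i \<and> i < k + Suc m then ys ! (i - k) else e i) f)"
    by (fastforce simp: length_Suc_conv)
  finally show ?case .
qed

lemma well_scoped_Conj: "0 < d \<Longrightarrow> well_scoped d (Conj fs) \<longleftrightarrow> (\<forall>f\<in>set fs. well_scoped d f)"
  by (induction fs) auto

lemma holds_Conj: "holds G S e (Conj fs) \<longleftrightarrow> (\<forall>f\<in>set fs. holds G S e f)"
  by (induction fs) auto

definition distinct_fm :: "nat \<Rightarrow> fm" where
  "distinct_fm m = Conj [Neg (Same i j). i \<leftarrow> [0..<m], j \<leftarrow> [0..<i]]"

lemma holds_distinct_fm:
  assumes "length xs = m" "\<And>i. i < m \<Longrightarrow> e i = xs ! i"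
  shows "holds G S e (distinct_fm m) \<longleftrightarrow> distinct xs"
proof -
  have "holds G S e (distinct_fm m) \<longleftrightarrow> (\<forall>i<m. \<forall>j<i. e i \<noteq> e j)"
    unfolding distinct_fm_def holds_Conj by auto
  also have "\<dots> \<longleftrightarrow> (\<forall>i<m. \<forall>j<i. xs ! i \<noteq> xs ! j)"
  proof -
    have "e i = e j \<longleftrightarrow> xs ! i = xs ! j" if "i < m" "j < i" for i j
      using that assms(2)[of i] assms(2)[of j] by simp
    then show ?thesis by blast
  qed
  also have "\<dots> \<longleftrightarrow> distinct xs"
  proof -
    have "xs ! i \<noteq> xs ! j" if "\<forall>i<m. \<forall>j<i. xs ! i \<noteq> xs ! j" "i < m" "j < m" "i \<noteq> j" for i j
      using that by (metis linorder_neqE_nat)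
    moreover have "xs ! i \<noteq> xs ! j" if "\<forall>i<m. \<forall>j<m. i \<noteq> j \<longrightarrow> xs ! i \<noteq> xs ! j" "i < m" "j < i" for i j
      using that by auto
    ultimately show ?thesis
      unfolding distinct_conv_nth assms(1) by blast
  qed
  finally show ?thesis .
qed

text \<open>For a fixed number of vertices, Hamiltonicity is first-order. The last conjunct, a
  disjunction by De Morgan, says that no vertex is missing from the list.\<close>

definition cycle_fm :: "nat \<Rightarrow> fm" where
  "cycle_fm m = Exs 0 m (And (distinct_fm m) (And (Conj [Adj i (Suc i mod m). i \<leftarrow> [0..<m]])
     (All m (Neg (Conj [Neg (Same m i). i \<leftarrow> [0..<m]])))))"

definition at_least_fm :: "nat \<Rightarrow> fm" where
  "at_least_fm m = Exs 0 m (distinct_fm m)"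

lemma well_scoped_size_fms:
  assumes "0 < m"
  shows "well_scoped 0 (cycle_fm m)" "well_scoped 0 (at_least_fm m)"
  using assms unfolding cycle_fm_def at_least_fm_def distinct_fm_def
  by (auto simp: well_scoped_Exs well_scoped_Conj)

lemma holds_cycle_fm:
  fixes G :: "'a ugraph"
  assumes "3 \<le> m"
  shows "holds G S e (cycle_fm m) \<longleftrightarrow> (\<exists>vs. is_cycle G vs \<and> set vs = verts G \<and> length vs = m)"
proof -
  have "holds G S e (cycle_fm m) \<longleftrightarrow> (\<exists>xs. length xs = m \<and> set xs \<subseteq> verts G \<and> distinct xs \<and>
      (\<forall>i<m. {xs ! i, xs ! (Suc i mod m)} \<in> edges G) \<and> (\<forall>x\<in>verts G. \<exists>i<m. x = xs ! i))"
    unfolding cycle_fm_def holds_Exs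
  proof (intro ex_cong1 conj_cong refl)
    fix xs :: "'a list" assume xs: "length xs = m"
    let ?e = "\<lambda>i. if 0 \<le> i \<and> i < 0 + m then xs ! (i - 0) else e i"
    have e: "?e i = xs ! i" "?e (Suc i mod m) = xs ! (Suc i mod m)" if "i < m" for i
      using that by auto
    have "holds G S ?e (distinct_fm m) \<longleftrightarrow> distinct xs"
      using xs e(1) by (rule holds_distinct_fm)
    moreover have "holds G S ?e (Conj [Adj i (Suc i mod m). i \<leftarrow> [0..<m]]) \<longleftrightarrow>
        (\<forall>i<m. {xs ! i, xs ! (Suc i mod m)} \<in> edges G)"
      using e by (auto simp: holds_Conj simp del: add_0)
    moreover have "holds G S ?e (All m (Neg (Conj [Neg (Same m i). i \<leftarrow> [0..<m]]))) \<longleftrightarrow>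
        (\<forall>x\<in>verts G. \<exists>i<m. x = xs ! i)"
      by (auto simp: holds_Conj Bex_def)
    ultimately show "holds G S ?e (And (distinct_fm m) (And (Conj [Adj i (Suc i mod m). i \<leftarrow> [0..<m]])
        (All m (Neg (Conj [Neg (Same m i). i \<leftarrow> [0..<m]]))))) \<longleftrightarrow>
      distinct xs \<and> (\<forall>i<m. {xs ! i, xs ! (Suc i mod m)} \<in> edges G) \<and>
      (\<forall>x\<in>verts G. \<exists>i<m. x = xs ! i)"
      unfolding holds.simps(5) by blast
  qed
  also have "\<dots> \<longleftrightarrow> (\<exists>vs. is_cycle G vs \<and> set vs = verts G \<and> length vs = m)"
  proof (intro ex_cong1 iffI)
    fix xs
    assume "is_cycle G xs \<and> set xs = verts G \<and> length xs = m"
    then show "length xs = m \<and> set xs \<subseteq> verts G \<and> distinct xs \<and>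
      (\<forall>i<m. {xs ! i, xs ! (Suc i mod m)} \<in> edges G) \<and> (\<forall>x\<in>verts G. \<exists>i<m. x = xs ! i)"
      unfolding is_cycle_def by (metis in_set_conv_nth)
  next
    fix xs
    assume xs: "length xs = m \<and> set xs \<subseteq> verts G \<and> distinct xs \<and>
      (\<forall>i<m. {xs ! i, xs ! (Suc i mod m)} \<in> edges G) \<and> (\<forall>x\<in>verts G. \<exists>i<m. x = xs ! i)"
    then have "verts G \<subseteq> set xs"
      by (metis nth_mem subsetI)
    with xs assms show "is_cycle G xs \<and> set xs = verts G \<and> length xs = m"
      unfolding is_cycle_def by blast
  qed
  finally show ?thesis .
qed

lemma holds_at_least_fm:
  assumes "finite (verts G)"
  shows "holds G S e (at_least_fm m) \<longleftrightarrow> m \<le> card (verts G)"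
proof -
  have "holds G S e (at_least_fm m) \<longleftrightarrow> (\<exists>xs. length xs = m \<and> set xs \<subseteq> verts G \<and> distinct xs)"
    unfolding at_least_fm_def holds_Exs
    by (intro ex_cong1 conj_cong refl) (auto simp: holds_distinct_fm)
  also have "\<dots> \<longleftrightarrow> (\<exists>A\<subseteq>verts G. card A = m)"
    using assms by (metis distinct_card finite_distinct_list finite_subset)
  also have "\<dots> \<longleftrightarrow> m \<le> card (verts G)"
    using assms by (metis card_mono obtain_subset_with_card_n)
  finally show ?thesis .
qed

section \<open>Degrees, ears and diamonds as formulas\<close>

definition degree2_fm :: "nat \<Rightarrow> nat \<Rightarrow> fm" where
  "degree2_fm x k = Ex k (Ex (Suc k) (And (Neg (Same k (Suc k))) (And (And (Adj x k) (Adj x (Suc k)))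
     (All (k + 2) (Or (Neg (Adj x (k + 2))) (Or (Same (k + 2) k) (Same (k + 2) (Suc k))))))))"

definition degree3_fm :: "nat \<Rightarrow> nat \<Rightarrow> fm" where
  "degree3_fm x k = Ex k (Ex (Suc k) (Ex (k + 2) (And (And (Neg (Same k (Suc k)))
       (And (Neg (Same (Suc k) (k + 2))) (Neg (Same k (k + 2)))))
     (And (And (Adj x k) (And (Adj x (Suc k)) (Adj x (k + 2))))
     (All (k + 3) (Or (Neg (Adj x (k + 3)))
       (Or (Same (k + 3) k) (Or (Same (k + 3) (Suc k)) (Same (k + 3) (k + 2))))))))))"

lemma well_scoped_degree_fm:
  assumes "x < k" "d = k"
  shows "well_scoped d (degree2_fm x k)" "well_scoped d (degree3_fm x k)"
  using assms unfolding degree2_fm_def degree3_fm_def by auto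

lemma holds_degree_fm:
  assumes G: "simple_graph G" and x: "x < k"
  shows "holds G S e (degree2_fm x k) \<longleftrightarrow> card (nb G (e x)) = 2"
    and "holds G S e (degree3_fm x k) \<longleftrightarrow> card (nb G (e x)) = 3"
proof -
  let ?N = "nb G (e x)"
  have sub: "?N \<subseteq> verts G" by (rule nb_subset[OF G])
  have "holds G S e (degree2_fm x k) \<longleftrightarrow> (\<exists>a\<in>verts G. \<exists>b\<in>verts G. a \<noteq> b \<and> (a \<in> ?N \<and> b \<in> ?N) \<and>
      (\<forall>y\<in>verts G. y \<in> ?N \<longrightarrow> y = a \<or> y = b))"
    using x unfolding degree2_fm_def nb_def by simp
  also have "\<dots> \<longleftrightarrow> (\<exists>a b. ?N = {a, b} \<and> a \<noteq> b)"
    using sub by blast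
  finally show "holds G S e (degree2_fm x k) \<longleftrightarrow> card ?N = 2"
    unfolding card_2_iff .
  have "holds G S e (degree3_fm x k) \<longleftrightarrow> (\<exists>a\<in>verts G. \<exists>b\<in>verts G. \<exists>c\<in>verts G.
      (a \<noteq> b \<and> b \<noteq> c \<and> a \<noteq> c) \<and> (a \<in> ?N \<and> b \<in> ?N \<and> c \<in> ?N) \<and>
      (\<forall>y\<in>verts G. y \<in> ?N \<longrightarrow> y = a \<or> y = b \<or> y = c))"
    using x unfolding degree3_fm_def nb_def by simp
  also have "\<dots> \<longleftrightarrow> (\<exists>a b c. ?N = {a, b, c} \<and> a \<noteq> b \<and> b \<noteq> c \<and> a \<noteq> c)"
    using sub by (intro iffI; elim exE bexE conjE) blast+
  finally show "holds G S e (degree3_fm x k) \<longleftrightarrow> card ?N = 3"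
    unfolding card_3_iff .
qed

text \<open>Level 0 is the vertex in question, level 1 its partner. The degree formulas and the
  inner quantifier reuse level 2 in disjoint scopes.\<close>

definition ear_fm :: fm where
  "ear_fm = Ex 1 (And (Adj 0 1) (And (degree3_fm 0 2) (And (degree3_fm 1 2)
     (Ex 2 (And (Adj 0 2) (And (Adj 1 2) (degree2_fm 2 3)))))))"

definition diamond_fm :: fm where
  "diamond_fm = Ex 1 (Ex 2 (Ex 3 (Ex 4 (And (And (Adj 1 2) (And (Adj 1 3) (And (Adj 2 3)
     (And (Adj 1 4) (And (Adj 2 4) (And (Neg (Same 3 4)) (And (degree3_fm 1 5) (And (degree3_fm 2 5)
     (And (degree3_fm 3 5) (degree3_fm 4 5))))))))))
     (Or (Same 0 1) (Or (Same 0 2) (Or (Same 0 3) (Same 0 4))))))))"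

definition traversable_fm :: fm where
  "traversable_fm = Or (degree2_fm 0 1) (And (degree3_fm 0 1) (Or ear_fm diamond_fm))"

lemma holds_traversable_fm:
  assumes G: "simple_graph G"
  shows "holds G S e traversable_fm \<longleftrightarrow> locally_traversable G (e 0)"
proof -
  have V: "y \<in> nb G x \<Longrightarrow> y \<in> verts G" for x y
    using nb_subset[OF G] by blast
  have V': "y \<in> nb G x \<Longrightarrow> x \<in> verts G" for x y
    using V nb_sym by metis
  have adj: "{x, y} \<in> edges G \<longleftrightarrow> y \<in> nb G x" for x y
    by (simp add: nb_def)
  have "holds G S e ear_fm \<longleftrightarrow> (\<exists>v. ear G (e 0) v)"
    unfolding ear_fm_def ear_def by (simp add: holds_degree_fm[OF G] adj) (use V in blast)
  moreover have "holds G S e diamond_fm \<longleftrightarrow> (\<exists>u v p b. diamond G u v p b \<and> e 0 \<in> {u, v, p, b})"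
  proof -
    have "holds G S e diamond_fm \<longleftrightarrow> (\<exists>u\<in>verts G. \<exists>v\<in>verts G. \<exists>p\<in>verts G. \<exists>b\<in>verts G.
        diamond G u v p b \<and> e 0 \<in> {u, v, p, b})"
      unfolding diamond_fm_def diamond_def by (simp add: holds_degree_fm[OF G] adj conj_assoc)
    \<comment> \<open>All four vertices of a diamond lie on edges, so restricting the quantifiers to
      \<open>verts G\<close> loses nothing.\<close>
    also have "\<dots> \<longleftrightarrow> (\<exists>u v p b. diamond G u v p b \<and> e 0 \<in> {u, v, p, b})"
      unfolding diamond_def using V V' by meson
    finally show ?thesis .
  qed
  ultimately show ?thesis
    unfolding traversable_fm_def locally_traversable_def by (simp add: holds_degree_fm[OF G])
qed

lemma well_scoped_traversable_fm: "well_scoped 1 traversable_fm"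
  unfolding traversable_fm_def ear_fm_def diamond_fm_def by (simp add: well_scoped_degree_fm)

text \<open>The three cycle formulas settle the graphs with at most five vertices, as a cycle has at
  least three. For the others, \<open>Mark\<close> at every vertex expresses connectivity once the
  marks are the reached vertices.\<close>

definition hamilton_fm :: fm where
  "hamilton_fm = Or (cycle_fm 3) (Or (cycle_fm 4) (Or (cycle_fm 5)
     (And (at_least_fm 6) (All 0 (And (Mark 0) traversable_fm)))))"

lemma well_scoped_hamilton_fm: "well_scoped 0 hamilton_fm"
  unfolding hamilton_fm_def
  using well_scoped_traversable_fm by (simp add: well_scoped_size_fms)

lemma holds_hamilton_fm:
  fixes G :: "'a :: linorder ugraph"
  assumes G: "simple_graph G" "subgraph_free graph_H1 G" and vs: "verts G = set vs" "distinct vs"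
  shows "holds G (reached G vs) e hamilton_fm \<longleftrightarrow> has_hamilton_cycle G"
proof -
  have fin: "finite (verts G)" using vs by simp
  have "holds G (reached G vs) e hamilton_fm \<longleftrightarrow>
      (\<exists>m\<in>{3, 4, 5}. \<exists>xs. is_cycle G xs \<and> set xs = verts G \<and> length xs = m) \<or>
      6 \<le> card (verts G) \<and> (\<forall>x\<in>verts G. x \<in> reached G vs \<and> locally_traversable G x)"
    unfolding hamilton_fm_def
    by (simp add: holds_cycle_fm holds_at_least_fm[OF fin] holds_traversable_fm[OF G(1)]) blast
  also have "\<dots> \<longleftrightarrow> has_hamilton_cycle G"
  proof (cases "6 \<le> card (verts G)")
    case True
    then have "vs \<noteq> []" using vs by auto
    then have "(\<forall>x\<in>verts G. x \<in> reached G vs \<and> locally_traversable G x) \<longleftrightarrow>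
        graph_connected G \<and> (\<forall>x\<in>verts G. locally_traversable G x)"
      using graph_connected_iff_reached[OF G(1) vs] by blast
    moreover have "has_hamilton_cycle G" if "is_cycle G xs" "set xs = verts G" for xs
      using that unfolding has_hamilton_cycle_def by blast
    ultimately show ?thesis
      using True hamilton_cycle_iff_traversable[OF G True] by blast
  next
    case False
    have "length xs \<in> {3, 4, 5}" if "is_cycle G xs" "set xs = verts G" for xs
    proof -
      have "length xs = card (verts G)" "3 \<le> length xs"
        using that distinct_card[of xs] unfolding is_cycle_def by auto
      with False show ?thesis by auto
    qed
    with False show ?thesis
      unfolding has_hamilton_cycle_def by blast
  qed
  finally show ?thesis .
qed

theorem theorem6:
  "solvable_in_polynomial_time_on has_hamilton_cycle
     {G. simple_graph G \<and> subgraph_free graph_H1 G}"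
proof -
  obtain b where b: "\<And>n. decide_cost hamilton_fm n \<le> poly b (n * n)"
    using poly_bounded_decide_cost unfolding poly_bounded_def by blast
  have "\<exists>t r m. exec (decide_prog hamilton_fm) (initial_config (adjacency_word vs G)) t (r, m) \<and>
      t \<le> poly b (length (adjacency_word vs G)) \<and> r 0 = (if has_hamilton_cycle G then 1 else 0)"
    if G: "simple_graph G" "subgraph_free graph_H1 G" "distinct vs" "set vs = verts G"
    for G :: "nat ugraph" and vs
  proof -
    obtain r m where "runs (decide_prog hamilton_fm) (initial_config (adjacency_word vs G))
        (decide_cost hamilton_fm (length vs)) (r, m)"
      "r 0 = (if holds G (reached G vs) (\<lambda>_. 0) hamilton_fm then 1 else 0)"
      using runs_decide_prog[OF G(4)[symmetric] G(3) well_scoped_hamilton_fm] by blast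
    moreover note holds_hamilton_fm[OF G(1,2) G(4)[symmetric] G(3)]
    ultimately show ?thesis
      unfolding runs_def length_adjacency_word using b order_trans by metis
  qed
  then show ?thesis
    unfolding solvable_in_polynomial_time_on_def by blast
qed

end
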